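(* Let $G$ be a non-elementary torsion-free hyperbolic group. Then $G$ satisfies the following Property ( * ): for each finite subset $M$ of $G$ consisting of elements not equal to $1$, and for every integer $m\geq 2$, there exist distinct $a,b,c\in G$ such that whenever $$(x_1^{-1}g_1x_1)(x_2^{-1}g_2x_2)\cdots(x_m^{-1}g_mx_m)=1$$ with $g_i\in M$ and $x_i\in\{a,b,c\}$ for all $i=1,\dots,m$, then $x_i=x_{i+1}$ for some $i\in\{1,\dots,m-1\}$.
   Context: Hyperbolic groups: let $G$ be a group with finite generating set $X$. The Cayley graph $\Gamma_X(G)$ has vertex set $G$ and an $x$-labelled edge directed from $g$ to $gx$ for all $g\in G$, $x\in X$; giving each edge length one makes it a geodesic metric space. For a real constant $\delta>0$, $\Gamma_X(G)$ satisfies the $\delta$-thin triangles condition if every side of every geodesic triangle is contained in the $\delta$-neighborhood of the union of the other two sides. $G$ is hyperbolic if it admits a finite generating set $X$ and a real $\delta>0$ such that $\Gamma_X(G)$ satisfies the $\delta$-thin triangles condition. A hyperbolic group is elementary if it is finite or virtually infinite cyclic (has an infinite cyclic subgroup of finite index), and non-elementary otherwise. *)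

theory Defs
  imports "HOL-Analysis.Abstract_Metric_Spaces" "HOL-Algebra.Elementary_Groups"
begin

section \<open>Thin geodesic triangles in metric spaces\<close>

context Metric_space
begin

definition geodesic_segment :: "'a set \<Rightarrow> 'a \<Rightarrow> 'a \<Rightarrow> bool" where
  "geodesic_segment S p q \<longleftrightarrow> S \<subseteq> M \<and>
     (\<exists>\<gamma> :: real \<Rightarrow> 'a. \<gamma> 0 = p \<and> \<gamma> (d p q) = q \<and> \<gamma> ` {0..d p q} = S \<and>
        (\<forall>s\<in>{0..d p q}. \<forall>t\<in>{0..d p q}. d (\<gamma> s) (\<gamma> t) = \<bar>s - t\<bar>))"

definition nbhd :: "real \<Rightarrow> 'a set \<Rightarrow> 'a set" where
  "nbhd \<delta> A = (\<Union>a\<in>A. mball a \<delta>)"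

definition geodesic_triangle :: "'a set \<Rightarrow> 'a set \<Rightarrow> 'a set \<Rightarrow> bool" where
  "geodesic_triangle A B C \<longleftrightarrow>
     (\<exists>p q r. geodesic_segment A p q \<and> geodesic_segment B q r \<and> geodesic_segment C r p)"

definition thin_triangles :: "real \<Rightarrow> bool" where
  "thin_triangles \<delta> \<longleftrightarrow>
     (\<forall>A B C. geodesic_triangle A B C \<longrightarrow>
        A \<subseteq> nbhd \<delta> (B \<union> C) \<and> B \<subseteq> nbhd \<delta> (A \<union> C) \<and> C \<subseteq> nbhd \<delta> (A \<union> B))"

text \<open>1-Lipschitz paths of length \<open>L\<close>; an auxiliary notion for exhibiting geodesics.\<close>

definition lip_path :: "'a \<Rightarrow> 'a \<Rightarrow> real \<Rightarrow> bool" where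
  "lip_path p q L \<longleftrightarrow> 0 \<le> L \<and> (\<exists>c :: real \<Rightarrow> 'a. c 0 = p \<and> c L = q \<and> c ` {0..L} \<subseteq> M \<and>
     (\<forall>s\<in>{0..L}. \<forall>t\<in>{0..L}. d (c s) (c t) \<le> \<bar>s - t\<bar>))"

lemma lip_path_imp_geodesic:
  assumes "lip_path p q (d p q)"
  shows "\<exists>S. geodesic_segment S p q"
proof -
  obtain c :: "real \<Rightarrow> 'a" where c: "c 0 = p" "c (d p q) = q" "c ` {0..d p q} \<subseteq> M"
    and lip: "\<And>s t. s \<in> {0..d p q} \<Longrightarrow> t \<in> {0..d p q} \<Longrightarrow> d (c s) (c t) \<le> \<bar>s - t\<bar>"
    using assms unfolding lip_path_def by blast
  let ?L = "d p q"
  have *: "d (c s) (c t) = \<bar>s - t\<bar>" if st: "s \<in> {0..?L}" "t \<in> {0..?L}" "s \<le> t" for s t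
  proof -
    have "0 \<in> {0..?L}" "?L \<in> {0..?L}" by auto
    then have m: "c s \<in> M" "c t \<in> M" "p \<in> M" "q \<in> M" using c st by (metis image_subset_iff)+
    have "d p q \<le> d p (c s) + d (c s) (c t) + d (c t) q"
      using triangle[of p "c s" q] triangle[of "c s" "c t" q] m by linarith
    moreover have "d p (c s) \<le> s" using lip[of 0 s] c st by auto
    moreover have "d (c t) q \<le> ?L - t" using lip[of t ?L] c st by auto
    ultimately show ?thesis using lip[of s t] st by auto
  qed
  have **: "d (c s) (c t) = \<bar>s - t\<bar>" if st: "s \<in> {0..?L}" "t \<in> {0..?L}" for s t
    using *[of s t] *[of t s] st commute[of "c s" "c t"] by (cases "s \<le> t") auto
  show ?thesis
    unfolding geodesic_segment_def using c ** by blast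
qed

lemma lip_path_sym: "lip_path p q L \<Longrightarrow> lip_path q p L"
  unfolding lip_path_def
proof (elim conjE exE, intro conjI)
  fix c :: "real \<Rightarrow> 'a"
  assume L: "0 \<le> L" and c: "c 0 = p" "c L = q" "c ` {0..L} \<subseteq> M"
    and lip: "\<forall>s\<in>{0..L}. \<forall>t\<in>{0..L}. d (c s) (c t) \<le> \<bar>s - t\<bar>"
  show "\<exists>c. c 0 = q \<and> c L = p \<and> c ` {0..L} \<subseteq> M \<and>
     (\<forall>s\<in>{0..L}. \<forall>t\<in>{0..L}. d (c s) (c t) \<le> \<bar>s - t\<bar>)"
  proof (intro exI[of _ "\<lambda>s. c (L - s)"] conjI ballI)
    fix s t assume "s \<in> {0..L}" "t \<in> {0..L}"
    then have "d (c (L - s)) (c (L - t)) \<le> \<bar>(L - s) - (L - t)\<bar>"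
      by (intro lip[rule_format]) auto
    then show "d (c (L - s)) (c (L - t)) \<le> \<bar>s - t\<bar>" by linarith
  qed (use c in auto)
qed

lemma lip_path_trans:
  assumes "lip_path p q K" "lip_path q r L"
  shows "lip_path p r (K + L)"
proof -
  obtain a :: "real \<Rightarrow> 'a" where a: "a 0 = p" "a K = q" "a ` {0..K} \<subseteq> M" and K: "0 \<le> K"
    and lipa: "\<And>s t. s \<in> {0..K} \<Longrightarrow> t \<in> {0..K} \<Longrightarrow> d (a s) (a t) \<le> \<bar>s - t\<bar>"
    using assms(1) unfolding lip_path_def by blast
  obtain b :: "real \<Rightarrow> 'a" where b: "b 0 = q" "b L = r" "b ` {0..L} \<subseteq> M" and L: "0 \<le> L"
    and lipb: "\<And>s t. s \<in> {0..L} \<Longrightarrow> t \<in> {0..L} \<Longrightarrow> d (b s) (b t) \<le> \<bar>s - t\<bar>"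
    using assms(2) unfolding lip_path_def by blast
  define c where "c s = (if s \<le> K then a s else b (s - K))" for s
  have cM: "c s \<in> M" if "s \<in> {0..K+L}" for s
    using that a(3) b(3) by (auto simp: c_def)
  have q: "q \<in> M" using a(2,3) K by (auto simp: image_subset_iff)
  have *: "d (c s) (c t) \<le> \<bar>s - t\<bar>" if st: "s \<in> {0..K+L}" "t \<in> {0..K+L}" "s \<le> t" for s t
  proof -
    consider "t \<le> K" | "s \<le> K" "K < t" | "K < s" using st by linarith
    then show ?thesis
    proof cases
      case 1
      then show ?thesis using lipa[of s t] st by (auto simp: c_def)
    next
      case 2
      have "d (c s) (c t) \<le> d (c s) q + d q (c t)"
        by (intro triangle cM q st)
      moreover have "d (c s) q \<le> K - s" using lipa[of s K] 2 st a by (auto simp: c_def)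
      moreover have "d q (c t) \<le> t - K" using lipb[of 0 "t - K"] 2 st b by (auto simp: c_def)
      ultimately show ?thesis by linarith
    next
      case 3
      then show ?thesis using lipb[of "s - K" "t - K"] st by (auto simp: c_def)
    qed
  qed
  have **: "d (c s) (c t) \<le> \<bar>s - t\<bar>" if st: "s \<in> {0..K+L}" "t \<in> {0..K+L}" for s t
    using *[of s t] *[of t s] st commute[of "c s" "c t"] by (cases "s \<le> t") auto
  have "c (K + L) = r"
    using K L a b by (cases "L = 0") (auto simp: c_def)
  then show ?thesis
    unfolding lip_path_def
  proof (intro conjI exI[of _ c])
    show "c 0 = p" using K a by (simp add: c_def)
    show "c ` {0..K + L} \<subseteq> M" using cM by blast
  qed (use K L ** in auto)
qed

end


section \<open>Cayley graphs\<close>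

definition cayley_edges :: "('a, 'b) monoid_scheme \<Rightarrow> 'a set \<Rightarrow> ('a \<times> 'a) set" where
  "cayley_edges G X = {(g, g \<otimes>\<^bsub>G\<^esub> x) | g x. g \<in> carrier G \<and> x \<in> X}"

definition cayley_vdist :: "('a, 'b) monoid_scheme \<Rightarrow> 'a set \<Rightarrow> 'a \<Rightarrow> 'a \<Rightarrow> nat" where
  "cayley_vdist G X g h = (LEAST n. (g, h) \<in> (cayley_edges G X \<union> (cayley_edges G X)\<inverse>) ^^ n)"

text \<open>
  Points of the geometric realisation. \<open>Inner g x t\<close> is the point at distance \<open>t\<close> from \<open>g\<close> on the
  \<open>x\<close>-labelled edge from \<open>g\<close> to \<open>g \<otimes> x\<close>. Only \<open>0 < t < 1\<close> is used, so no points have to be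
  identified. Differently labelled edges, and an edge and its reverse, are distinct, and edges
  labelled \<open>\<one>\<close> are loops.
\<close>

datatype 'a cayley_point = Vertex 'a | Inner 'a 'a real

definition cayley_space :: "('a, 'b) monoid_scheme \<Rightarrow> 'a set \<Rightarrow> 'a cayley_point set" where
  "cayley_space G X = Vertex ` carrier G \<union>
     {Inner g x t | g x t. g \<in> carrier G \<and> x \<in> X \<and> 0 < t \<and> t < 1}"

text \<open>The vertices next to a point, with their distance along the edge carrying the point.\<close>

fun cayley_ends :: "('a, 'b) monoid_scheme \<Rightarrow> 'a cayley_point \<Rightarrow> ('a \<times> real) set" where
  "cayley_ends G (Vertex g) = {(g, 0)}"
| "cayley_ends G (Inner g x t) = {(g, dist 0 t), (g \<otimes>\<^bsub>G\<^esub> x, dist t 1)}"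

text \<open>The length of the segment joining two points inside a single open edge, if there is one.\<close>

fun cayley_along :: "'a cayley_point \<Rightarrow> 'a cayley_point \<Rightarrow> real set" where
  "cayley_along (Inner g x s) (Inner h y t) = (if g = h \<and> x = y then {dist s t} else {})"
| "cayley_along _ _ = {}"

text \<open>
  The path metric with all edges of length one: a shortest path either stays inside one open edge,
  or leaves the edge of \<open>p\<close> through a vertex \<open>u\<close> and enters the edge of \<open>q\<close> through a vertex \<open>v\<close>.
\<close>

definition cayley_dist ::
    "('a, 'b) monoid_scheme \<Rightarrow> 'a set \<Rightarrow> 'a cayley_point \<Rightarrow> 'a cayley_point \<Rightarrow> real" where
  "cayley_dist G X p q =
     Min ((\<lambda>((u, a), (v, b)). a + real (cayley_vdist G X u v) + b) `
            (cayley_ends G p \<times> cayley_ends G q) \<union> cayley_along p q)"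


subsection \<open>The Cayley graph is a geodesic metric space\<close>

lemma cayley_ends_finite [simp]: "finite (cayley_ends G p)"
  by (cases p) auto

lemma cayley_ends_nonempty [simp]: "cayley_ends G p \<noteq> {}"
  by (cases p) auto

lemma cayley_along_finite [simp]: "finite (cayley_along p q)"
  by (induction p q rule: cayley_along.induct) auto

lemma cayley_ends_nonneg: "(u, a) \<in> cayley_ends G p \<Longrightarrow> 0 \<le> a"
  by (cases p) auto

lemma cayley_along_nonneg: "a \<in> cayley_along p q \<Longrightarrow> 0 \<le> a"
  by (induction p q rule: cayley_along.induct) (auto split: if_splits)

lemma cayley_along_commute: "cayley_along p q = cayley_along q p"
  by (cases p; cases q) (auto simp: dist_commute)

lemma cayley_vdist_commute: "cayley_vdist G X g h = cayley_vdist G X h g"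
proof -
  let ?R = "cayley_edges G X \<union> (cayley_edges G X)\<inverse>"
  have "(h, g) \<in> ?R ^^ n" if "(g, h) \<in> ?R ^^ n" for n g h
    using that
  proof (induction n arbitrary: h)
    case (Suc n)
    then obtain k where "(g, k) \<in> ?R ^^ n" "(k, h) \<in> ?R" by auto
    then have "(h, k) \<in> ?R" "(k, g) \<in> ?R ^^ n" using Suc.IH by auto
    then show ?case by (rule relpow_Suc_I2)
  qed auto
  then have "(g, h) \<in> ?R ^^ n \<longleftrightarrow> (h, g) \<in> ?R ^^ n" for n by blast
  then show ?thesis by (simp add: cayley_vdist_def)
qed

lemma cayley_vdist_self [simp]: "cayley_vdist G X g g = 0"
  unfolding cayley_vdist_def by (rule Least_eq_0) auto

lemma cayley_dist_cases:
  obtains (through) u a v b where "(u, a) \<in> cayley_ends G p" "(v, b) \<in> cayley_ends G q"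
      "cayley_dist G X p q = a + real (cayley_vdist G X u v) + b"
    | (along) "cayley_dist G X p q \<in> cayley_along p q"
proof -
  let ?S = "(\<lambda>((u, a), (v, b)). a + real (cayley_vdist G X u v) + b) `
            (cayley_ends G p \<times> cayley_ends G q)"
  have "cayley_dist G X p q \<in> ?S \<union> cayley_along p q"
    unfolding cayley_dist_def by (rule Min_in) auto
  then show thesis using that by auto
qed

lemma cayley_dist_le_through:
  assumes "(u, a) \<in> cayley_ends G p" "(v, b) \<in> cayley_ends G q"
  shows "cayley_dist G X p q \<le> a + real (cayley_vdist G X u v) + b"
  unfolding cayley_dist_def by (rule Min_le) (use assms in force)+

lemma cayley_dist_le_along: "c \<in> cayley_along p q \<Longrightarrow> cayley_dist G X p q \<le> c"
  unfolding cayley_dist_def by (rule Min_le) auto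

lemma cayley_dist_nonneg: "0 \<le> cayley_dist G X p q"
proof (cases rule: cayley_dist_cases[of G p q X])
  case (through u a v b)
  then show ?thesis
    using cayley_ends_nonneg[of u a G p] cayley_ends_nonneg[of v b G q] by simp
next
  case along
  then show ?thesis by (rule cayley_along_nonneg)
qed

lemma cayley_dist_commute_le: "cayley_dist G X p q \<le> cayley_dist G X q p"
proof (cases rule: cayley_dist_cases[of G q p X])
  case (through u a v b)
  then show ?thesis
    using cayley_dist_le_through[of v b G p u a q X] by (simp add: cayley_vdist_commute)
next
  case along
  then have "cayley_dist G X q p \<in> cayley_along p q"
    by (simp only: cayley_along_commute[of q p])
  then show ?thesis by (rule cayley_dist_le_along)
qed

context group
begin

lemma cayley_connected:
  assumes "generate G X = carrier G" "g \<in> carrier G" "h \<in> carrier G"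
  shows "\<exists>n. (g, h) \<in> (cayley_edges G X \<union> (cayley_edges G X)\<inverse>) ^^ n"
proof -
  let ?R = "cayley_edges G X \<union> (cayley_edges G X)\<inverse>"
  have XG: "X \<subseteq> carrier G" using assms(1) generate.incl[of _ X G] by auto
  have *: "(k, k \<otimes> a) \<in> ?R\<^sup>*" if "a \<in> generate G X" "k \<in> carrier G" for a k
    using that
  proof (induction arbitrary: k rule: generate.induct)
    case one
    then show ?case by simp
  next
    case (incl a)
    then have "(k, k \<otimes> a) \<in> ?R" by (auto simp: cayley_edges_def)
    then show ?case by (rule r_into_rtrancl)
  next
    case (inv a)
    then have "(k \<otimes> inv a, (k \<otimes> inv a) \<otimes> a) \<in> cayley_edges G X"
      using XG by (auto simp: cayley_edges_def)
    moreover have "(k \<otimes> inv a) \<otimes> a = k" using inv XG by (auto simp: m_assoc)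
    ultimately have "(k, k \<otimes> inv a) \<in> ?R" by simp
    then show ?case by (rule r_into_rtrancl)
  next
    case (eng a b)
    then have ab: "a \<in> carrier G" "b \<in> carrier G" using assms(1) by auto
    have "(k, k \<otimes> a) \<in> ?R\<^sup>*" "(k \<otimes> a, (k \<otimes> a) \<otimes> b) \<in> ?R\<^sup>*"
      using eng ab by blast+
    then have "(k, (k \<otimes> a) \<otimes> b) \<in> ?R\<^sup>*" by (rule rtrancl_trans)
    then show ?case using ab eng.prems by (simp add: m_assoc)
  qed
  have "inv g \<otimes> h \<in> generate G X" using assms by auto
  moreover have "g \<otimes> (inv g \<otimes> h) = h"
    using assms(2,3) by (metis inv_closed l_one m_assoc r_inv)
  ultimately have "(g, h) \<in> ?R\<^sup>*" using *[OF _ assms(2)] by metis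
  then show ?thesis by (rule rtrancl_imp_relpow[THEN exE]) blast
qed

context
  fixes X :: "'a set"
  assumes gen: "generate G X = carrier G"
begin

lemma cayley_vdist_relpow:
  assumes "g \<in> carrier G" "h \<in> carrier G"
  shows "(g, h) \<in> (cayley_edges G X \<union> (cayley_edges G X)\<inverse>) ^^ cayley_vdist G X g h"
  unfolding cayley_vdist_def using cayley_connected[OF gen assms] by (rule LeastI_ex)

lemma cayley_vdist_le:
  "(g, h) \<in> (cayley_edges G X \<union> (cayley_edges G X)\<inverse>) ^^ n \<Longrightarrow> cayley_vdist G X g h \<le> n"
  unfolding cayley_vdist_def by (rule Least_le)

lemma cayley_vdist_triangle:
  assumes "g \<in> carrier G" "h \<in> carrier G" "k \<in> carrier G"
  shows "cayley_vdist G X g k \<le> cayley_vdist G X g h + cayley_vdist G X h k"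
  by (rule cayley_vdist_le)
     (use cayley_vdist_relpow[of g h] cayley_vdist_relpow[of h k] assms
      in \<open>auto simp: relpow_add\<close>)

lemma cayley_vdist_eq_0:
  "g \<in> carrier G \<Longrightarrow> h \<in> carrier G \<Longrightarrow> cayley_vdist G X g h = 0 \<Longrightarrow> g = h"
  using cayley_vdist_relpow[of g h] by simp

lemma cayley_ends_carrier:
  "p \<in> cayley_space G X \<Longrightarrow> (u, a) \<in> cayley_ends G p \<Longrightarrow> u \<in> carrier G"
  using gen generate.incl[of _ X G] by (auto simp: cayley_space_def)

lemma cayley_ends_width:
  assumes "p \<in> cayley_space G X" "(u, a) \<in> cayley_ends G p" "(v, b) \<in> cayley_ends G p"
  shows "real (cayley_vdist G X u v) \<le> a + b"
proof -
  have "cayley_vdist G X g (g \<otimes> x) \<le> 1" if "g \<in> carrier G" "x \<in> X" for g x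
    by (rule cayley_vdist_le) (use that in \<open>auto simp: cayley_edges_def\<close>)
  moreover from this have "cayley_vdist G X (g \<otimes> x) g \<le> 1" if "g \<in> carrier G" "x \<in> X" for g x
    using that by (simp add: cayley_vdist_commute)
  ultimately show ?thesis
    using assms by (fastforce simp: cayley_space_def dist_real_def)
qed

lemma cayley_along_ends:
  assumes "c \<in> cayley_along p q" "(v, b) \<in> cayley_ends G q"
  shows "\<exists>a. (v, a) \<in> cayley_ends G p \<and> a \<le> c + b"
  using assms by (cases p; cases q) (auto split: if_splits simp: dist_real_def)

lemma cayley_dist_triangle:
  assumes "p \<in> cayley_space G X" "q \<in> cayley_space G X" "r \<in> cayley_space G X"
  shows "cayley_dist G X p r \<le> cayley_dist G X p q + cayley_dist G X q r"
proof (cases rule: cayley_dist_cases[of G p q X])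
  case pq: (through u a v b)
  show ?thesis
  proof (cases rule: cayley_dist_cases[of G q r X])
    case qr: (through v' b' w c)
    have c: "u \<in> carrier G" "v \<in> carrier G" "v' \<in> carrier G" "w \<in> carrier G"
      using pq qr assms cayley_ends_carrier by blast+
    have "cayley_dist G X p r \<le> a + real (cayley_vdist G X u w) + c"
      using pq qr by (intro cayley_dist_le_through)
    moreover have "real (cayley_vdist G X v v') \<le> b + b'"
      using pq qr assms by (intro cayley_ends_width)
    ultimately show ?thesis
      using pq qr cayley_vdist_triangle[of u v w] cayley_vdist_triangle[of v v' w] c by linarith
  next
    case qr: along
    then obtain c where "(v, c) \<in> cayley_ends G r" "c \<le> cayley_dist G X q r + b"
      using cayley_along_ends[of _ r q v b] pq by (metis cayley_along_commute)
    then show ?thesis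
      using cayley_dist_le_through[of u a G p v c r X] pq by linarith
  qed
next
  case pq: along
  show ?thesis
  proof (cases rule: cayley_dist_cases[of G q r X])
    case qr: (through v b w c)
    then obtain a where "(v, a) \<in> cayley_ends G p" "a \<le> cayley_dist G X p q + b"
      using cayley_along_ends[OF pq] by metis
    then show ?thesis
      using cayley_dist_le_through[of v a G p w c r X] qr by linarith
  next
    case qr: along
    have "\<exists>e. e \<in> cayley_along p r \<and> e \<le> cayley_dist G X p q + cayley_dist G X q r"
      using pq qr by (cases p; cases q; cases r) (auto split: if_splits intro: dist_triangle)
    then obtain e where "e \<in> cayley_along p r" "e \<le> cayley_dist G X p q + cayley_dist G X q r"
      by blast
    then show ?thesis using cayley_dist_le_along[of e p r G X] by linarith
  qed
qed

lemma cayley_dist_eq_0: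
  assumes "p \<in> cayley_space G X" "q \<in> cayley_space G X" "cayley_dist G X p q = 0"
  shows "p = q"
proof (cases rule: cayley_dist_cases[of G p q X])
  case (through u a v b)
  then have "a = 0" "b = 0" "cayley_vdist G X u v = 0"
    using assms cayley_ends_nonneg[of u a G p] cayley_ends_nonneg[of v b G q] by auto
  moreover have "u \<in> carrier G" "v \<in> carrier G"
    using through assms cayley_ends_carrier by blast+
  ultimately show ?thesis
    using through assms cayley_vdist_eq_0[of u v] by (auto simp: cayley_space_def)
next
  case along
  then show ?thesis using assms by (cases p; cases q) (auto split: if_splits)
qed

lemma cayley_dist_self:
  assumes "p \<in> cayley_space G X"
  shows "cayley_dist G X p p = 0"
proof -
  have "cayley_dist G X p p \<le> 0"
  proof (cases p)
    case (Vertex g)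
    then show ?thesis using cayley_dist_le_through[of g 0 G p g 0 p X] by simp
  next
    case (Inner g x t)
    then show ?thesis by (intro cayley_dist_le_along) auto
  qed
  then show ?thesis using cayley_dist_nonneg[of G X p p] by linarith
qed

lemma cayley_metric: "Metric_space (cayley_space G X) (cayley_dist G X)"
proof
  show "cayley_dist G X p q = cayley_dist G X q p" for p q
    by (intro antisym cayley_dist_commute_le)
qed (auto intro: cayley_dist_nonneg cayley_dist_eq_0 cayley_dist_self cayley_dist_triangle)

interpretation C: Metric_space "cayley_space G X" "cayley_dist G X"
  by (rule cayley_metric)

text \<open>The closed edge, parametrised by \<open>[0, 1]\<close>.\<close>

definition cayley_edge_point :: "'a \<Rightarrow> 'a \<Rightarrow> real \<Rightarrow> 'a cayley_point" where
  "cayley_edge_point g x t =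
     (if t \<le> 0 then Vertex g else if 1 \<le> t then Vertex (g \<otimes> x) else Inner g x t)"

lemma cayley_edge_point_lip:
  assumes "g \<in> carrier G" "x \<in> X" "s \<in> {0..1}" "t \<in> {0..1}"
  shows "cayley_dist G X (cayley_edge_point g x s) (cayley_edge_point g x t) \<le> \<bar>s - t\<bar>"
proof -
  have *: "cayley_dist G X (cayley_edge_point g x s) (cayley_edge_point g x t) \<le> \<bar>s - t\<bar>"
    if st: "0 \<le> s" "s \<le> t" "t \<le> 1" for s t
  proof -
    have e: "cayley_vdist G X g (g \<otimes> x) \<le> 1"
      by (rule cayley_vdist_le) (use assms in \<open>auto simp: cayley_edges_def\<close>)
    consider "s = t" | "s = 0" "t = 1" | "s = 0" "0 < t" "t < 1" | "0 < s" "s < 1" "t = 1"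
      | "0 < s" "s < t" "t < 1" using st by linarith
    then show ?thesis
    proof cases
      case 1
      then have "cayley_edge_point g x s \<in> cayley_space G X"
        using assms st gen generate.incl[of x X G]
        by (auto simp: cayley_edge_point_def cayley_space_def)
      then show ?thesis using 1 cayley_dist_self by simp
    next
      case 2
      then show ?thesis
        using e cayley_dist_le_through[of g 0 G "Vertex g" "g \<otimes> x" 0 "Vertex (g \<otimes> x)" X]
        by (simp add: cayley_edge_point_def)
    next
      case 3
      then show ?thesis
        using cayley_dist_le_through[of g 0 G "Vertex g" g t "Inner g x t" X]
        by (simp add: cayley_edge_point_def dist_real_def)
    next
      case 4
      then show ?thesis
        using cayley_dist_le_through
          [of "g \<otimes> x" "1 - s" G "Inner g x s" "g \<otimes> x" 0 "Vertex (g \<otimes> x)" X]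
        by (simp add: cayley_edge_point_def dist_real_def)
    next
      case 5
      then show ?thesis
        using cayley_dist_le_along[of "\<bar>s - t\<bar>" "Inner g x s" "Inner g x t" G X]
        by (simp add: cayley_edge_point_def dist_real_def)
    qed
  qed
  show ?thesis
    using *[of s t] *[of t s] assms
      C.commute[of "cayley_edge_point g x s" "cayley_edge_point g x t"]
    by (cases "s \<le> t") auto
qed

lemma cayley_edge_lip_path:
  assumes "g \<in> carrier G" "x \<in> X" "0 \<le> s" "s \<le> t" "t \<le> 1"
  shows "C.lip_path (cayley_edge_point g x s) (cayley_edge_point g x t) (t - s)"
proof -
  have "cayley_edge_point g x (s + u) \<in> cayley_space G X" for u
    using assms gen generate.incl[of x X G]
    by (auto simp: cayley_edge_point_def cayley_space_def)
  moreover have "cayley_dist G X (cayley_edge_point g x (s + u)) (cayley_edge_point g x (s + v))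
      \<le> \<bar>u - v\<bar>" if "u \<in> {0..t-s}" "v \<in> {0..t-s}" for u v
    using cayley_edge_point_lip[of g x "s + u" "s + v"] that assms by auto
  ultimately show ?thesis
    unfolding C.lip_path_def using assms
    by (intro conjI exI[of _ "\<lambda>u. cayley_edge_point g x (s + u)"]) auto
qed

lemma cayley_vertex_lip_path:
  assumes "(g, h) \<in> (cayley_edges G X \<union> (cayley_edges G X)\<inverse>) ^^ n" "g \<in> carrier G"
  shows "C.lip_path (Vertex g) (Vertex h) (real n)"
  using assms(1)
proof (induction n arbitrary: h)
  case 0
  have "Vertex g \<in> cayley_space G X"
    using assms(2) by (simp add: cayley_space_def)
  then have "C.lip_path (Vertex g) (Vertex g) 0"
    unfolding C.lip_path_def by (intro conjI exI[of _ "\<lambda>_. Vertex g"]) auto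
  then show ?case using 0 by simp
next
  case (Suc n)
  then obtain k where k: "(g, k) \<in> (cayley_edges G X \<union> (cayley_edges G X)\<inverse>) ^^ n"
    and kh: "(k, h) \<in> cayley_edges G X \<or> (h, k) \<in> cayley_edges G X" by auto
  have edge: "C.lip_path (Vertex a) (Vertex b) 1" if "(a, b) \<in> cayley_edges G X" for a b
    using that cayley_edge_lip_path[of a _ 0 1]
    by (auto simp: cayley_edges_def cayley_edge_point_def)
  have "C.lip_path (Vertex k) (Vertex h) 1"
    using kh edge C.lip_path_sym by blast
  then show ?case
    using C.lip_path_trans[OF Suc.IH[OF k]] by (simp add: add.commute)
qed

lemma cayley_end_lip_path:
  assumes "p \<in> cayley_space G X" "(u, a) \<in> cayley_ends G p"
  shows "C.lip_path p (Vertex u) a"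
proof (cases p)
  case (Vertex g)
  then show ?thesis using assms cayley_vertex_lip_path[of g g 0]
    by (auto simp: cayley_space_def)
next
  case (Inner g x t)
  then have p: "g \<in> carrier G" "x \<in> X" "0 < t" "t < 1"
    using assms by (auto simp: cayley_space_def)
  have "C.lip_path p (Vertex g) t" "C.lip_path p (Vertex (g \<otimes> x)) (1 - t)"
    using cayley_edge_lip_path[of g x 0 t] cayley_edge_lip_path[of g x t 1] p Inner
    by (auto simp: cayley_edge_point_def intro: C.lip_path_sym)
  then show ?thesis using assms Inner p by (auto simp: dist_real_def)
qed

theorem cayley_geodesic:
  assumes "p \<in> cayley_space G X" "q \<in> cayley_space G X"
  shows "\<exists>S. Metric_space.geodesic_segment (cayley_space G X) (cayley_dist G X) S p q"
proof (rule C.lip_path_imp_geodesic, cases rule: cayley_dist_cases[of G p q X])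
  case (through u a v b)
  have "u \<in> carrier G" "v \<in> carrier G"
    using through assms cayley_ends_carrier by blast+
  then have "C.lip_path (Vertex u) (Vertex v) (real (cayley_vdist G X u v))"
    by (intro cayley_vertex_lip_path cayley_vdist_relpow)
  moreover have "C.lip_path p (Vertex u) a" "C.lip_path (Vertex v) q b"
    using through assms cayley_end_lip_path C.lip_path_sym by blast+
  ultimately show "C.lip_path p q (cayley_dist G X p q)"
    unfolding through(3) by (intro C.lip_path_trans)
next
  case along
  then obtain g x s t where pq: "p = Inner g x s" "q = Inner g x t"
    and D: "cayley_dist G X p q = \<bar>s - t\<bar>"
    by (cases p; cases q) (simp_all split: if_splits add: dist_real_def)
  have *: "g \<in> carrier G" "x \<in> X" "0 < s" "s < 1" "0 < t" "t < 1"
    using assms pq by (auto simp: cayley_space_def)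
  show "C.lip_path p q (cayley_dist G X p q)"
  proof (cases "s \<le> t")
    case True
    then show ?thesis
      using cayley_edge_lip_path[of g x s t] * D pq by (simp add: cayley_edge_point_def)
  next
    case False
    then show ?thesis
      using C.lip_path_sym[OF cayley_edge_lip_path[of g x t s]] * D pq
      by (simp add: cayley_edge_point_def)
  qed
qed

end

end


section \<open>Hyperbolic groups\<close>

definition hyperbolic_group :: "('a, 'b) monoid_scheme \<Rightarrow> bool" where
  "hyperbolic_group G \<longleftrightarrow> group G \<and>
     (\<exists>X \<delta>. finite X \<and> X \<subseteq> carrier G \<and> generate G X = carrier G \<and> \<delta> > 0 \<and>
        Metric_space.thin_triangles (cayley_space G X) (cayley_dist G X) \<delta>)"

definition virtually_infinite_cyclic :: "('a, 'b) monoid_scheme \<Rightarrow> bool" where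
  "virtually_infinite_cyclic G \<longleftrightarrow>
     (\<exists>H. subgroup H G \<and> cyclic_group (subgroup_generated G H) \<and> infinite H \<and>
        finite (rcosets\<^bsub>G\<^esub> H))"

definition elementary_group :: "('a, 'b) monoid_scheme \<Rightarrow> bool" where
  "elementary_group G \<longleftrightarrow> finite (carrier G) \<or> virtually_infinite_cyclic G"

definition torsion_free_group :: "('a, 'b) monoid_scheme \<Rightarrow> bool" where
  "torsion_free_group G \<longleftrightarrow>
     (\<forall>g\<in>carrier G. \<forall>n::nat. n > 0 \<and> g [^]\<^bsub>G\<^esub> n = \<one>\<^bsub>G\<^esub> \<longrightarrow> g = \<one>\<^bsub>G\<^esub>)"

definition property_star :: "('a, 'b) monoid_scheme \<Rightarrow> bool" where
  "property_star G \<longleftrightarrow>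
     (\<forall>M. \<forall>m::nat. finite M \<and> M \<subseteq> carrier G \<and> \<one>\<^bsub>G\<^esub> \<notin> M \<and> m \<ge> 2 \<longrightarrow>
        (\<exists>a\<in>carrier G. \<exists>b\<in>carrier G. \<exists>c\<in>carrier G. a \<noteq> b \<and> b \<noteq> c \<and> a \<noteq> c \<and>
           (\<forall>g x. (\<forall>i\<in>{1..m}. g i \<in> M \<and> x i \<in> {a, b, c}) \<and>
              foldr (\<otimes>\<^bsub>G\<^esub>) (map (\<lambda>i. inv\<^bsub>G\<^esub> (x i) \<otimes>\<^bsub>G\<^esub> g i \<otimes>\<^bsub>G\<^esub> x i) [1..<Suc m]) \<one>\<^bsub>G\<^esub> = \<one>\<^bsub>G\<^esub>
              \<longrightarrow> (\<exists>i\<in>{1..m - 1}. x i = x (i + 1)))))"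

end

theory Submission
  imports Defs
begin

text \<open>
  The product \<open>inv x\<^sub>1 \<otimes> g\<^sub>1 \<otimes> x\<^sub>1 \<otimes> \<dots> \<otimes> inv x\<^sub>m \<otimes> g\<^sub>m \<otimes> x\<^sub>m\<close> is read as a path in the Cayley graph that
  alternates between short steps \<open>g\<^sub>i\<close> and long steps \<open>x\<^sub>i \<otimes> inv x\<^sub>i\<^sub>+\<^sub>1\<close>. In a hyperbolic space such a
  path cannot close up if it makes no sharp turns, that is, if the Gromov products at its corners
  are small compared with the long steps (\<open>chain_progress\<close>). For elements \<open>u\<close> from the
  three-element set this needs two things: no \<open>g\<close> from \<open>M\<close> almost fixes the direction in which \<open>u\<close>
  leaves \<open>\<one>\<close>, so that \<open>u\<close> and \<open>g \<otimes> u\<close> have a bounded Gromov product, and the inverses of different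
  elements leave in different directions (\<open>conjugate_product_chain\<close>). The second
  condition reduces to the first: if \<open>inv y\<close> has a direction not almost fixed by the powers
  \<open>t [^] j\<close> with \<open>0 < \<bar>j\<bar> \<le> 2\<close> of some \<open>t \<noteq> \<one>\<close>, then \<open>y\<close>, \<open>y \<otimes> t\<close>, \<open>y \<otimes> t \<otimes> t\<close> will do. So it suffices to
  find arbitrarily long elements \<open>y\<close> such that neither the direction of \<open>y\<close> nor that of \<open>inv y\<close> is
  almost fixed by a nontrivial element of a given finite set (\<open>exists_generic_element\<close>).

  The direction of \<open>y\<close> is not almost fixed by \<open>g\<close> as soon as \<open>y\<close> starts with some \<open>h\<close> that \<open>g\<close> moves
  by more than a constant (\<open>displacement_of_prefix\<close>). The elements \<open>h\<close> that \<open>g\<close> moves only by a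
  bounded amount lie in finitely many cosets of the centraliser of \<open>g\<close>, hence in finitely
  many cosets of an infinite cyclic group; by Neumann's lemma on coverings by cosets
  (\<open>coset_covering_finite_index\<close>) these cannot exhaust a group that is not virtually cyclic.
  Finally \<open>y = p \<otimes> e \<otimes> inv p\<close>, where \<open>p\<close> is \<open>h\<close> followed by a long power of some \<open>w\<close> whose axis
  diverges from its translate by \<open>e\<close>, makes \<open>y\<close> long and lets both \<open>y\<close> and \<open>inv y\<close> start with \<open>h\<close>.

  That centralisers, and more generally commensurators, of elements of infinite order are
  virtually cyclic (\<open>commensurator_finite_index\<close>) rests on the fact that some power of each element
  of infinite order translates along a quasi-geodesic axis
  (\<open>infinite_order_imp_loxodromic_power\<close>). All of this is derived from the four-point inequality for
  the word metric, the finiteness of balls, and the existence of geodesics; the boundary of the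
  group appears only in the intuition.
\<close>

section \<open>From thin triangles to the four-point inequality\<close>

context Metric_space
begin

lemma geodesic_segment_betweenness:
  assumes "geodesic_segment S p q" "t \<in> S"
  shows "t \<in> M" "d p t + d t q = d p q"
proof -
  obtain \<gamma> where g: "\<gamma> 0 = p" "\<gamma> (d p q) = q" "\<gamma> ` {0..d p q} = S" "S \<subseteq> M"
    and iso: "\<And>s t. s \<in> {0..d p q} \<Longrightarrow> t \<in> {0..d p q} \<Longrightarrow> d (\<gamma> s) (\<gamma> t) = \<bar>s - t\<bar>"
    using assms(1) unfolding geodesic_segment_def by blast
  show "t \<in> M" using g assms(2) by blast
  obtain s where s: "s \<in> {0..d p q}" "t = \<gamma> s" using g(3) assms(2) by blast
  have "d p t = s" "d t q = d p q - s"
    using iso[of 0 s] iso[of s "d p q"] g(1,2) s by auto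
  then show "d p t + d t q = d p q" by simp
qed

lemma geodesic_segment_endpoints:
  assumes "geodesic_segment S p q"
  shows "p \<in> S" "q \<in> S"
proof -
  obtain \<gamma> where g: "\<gamma> 0 = p" "\<gamma> (d p q) = q" "\<gamma> ` {0..d p q} = S"
    using assms unfolding geodesic_segment_def by blast
  have "0 \<in> {0..d p q}" "d p q \<in> {0..d p q}" by auto
  then show "p \<in> S" "q \<in> S" using g by (metis imageI)+
qed

text \<open>
  A side of a thin triangle is covered by the neighbourhoods of the other two sides. Both are
  relatively open and each contains an endpoint of the side, so by connectedness they overlap.
\<close>

lemma thin_triangle_center:
  assumes thin: "thin_triangles \<delta>" and "\<delta> > 0"
    and A: "geodesic_segment A p q" and B: "geodesic_segment B q r" and C: "geodesic_segment C r p"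
  obtains t where "t \<in> A" "t \<in> nbhd \<delta> B" "t \<in> nbhd \<delta> C"
proof -
  obtain \<gamma> where g: "\<gamma> 0 = p" "\<gamma> (d p q) = q" "\<gamma> ` {0..d p q} = A" "A \<subseteq> M"
    and iso: "\<And>s t. s \<in> {0..d p q} \<Longrightarrow> t \<in> {0..d p q} \<Longrightarrow> d (\<gamma> s) (\<gamma> t) = \<bar>s - t\<bar>"
    using A unfolding geodesic_segment_def by blast
  let ?I = "{0..d p q}"
  have gM: "\<gamma> s \<in> M" if "s \<in> ?I" for s using g that by blast
  \<comment> \<open>an open set of reals that meets the interval in the parameters of the points near \<open>S\<close>\<close>
  define U where "U S = (\<Union>s\<in>?I. \<Union>b\<in>S. ball s (\<delta> - d b (\<gamma> s)))" for S
  have opn: "open (U S)" for S unfolding U_def by auto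
  have U: "U S \<inter> ?I = {s\<in>?I. \<gamma> s \<in> nbhd \<delta> S}" if S: "S \<subseteq> M" for S
  proof (intro equalityI subsetI)
    fix s' assume "s' \<in> U S \<inter> ?I"
    then obtain s b where s: "s \<in> ?I" "b \<in> S" "dist s s' < \<delta> - d b (\<gamma> s)" "s' \<in> ?I"
      unfolding U_def by auto
    have "d b (\<gamma> s') \<le> d b (\<gamma> s) + d (\<gamma> s) (\<gamma> s')"
      using S s gM by (intro triangle) auto
    then have "d b (\<gamma> s') < \<delta>" using iso[of s s'] s by (simp add: dist_real_def)
    then show "s' \<in> {s\<in>?I. \<gamma> s \<in> nbhd \<delta> S}" using s S gM unfolding nbhd_def by auto
  next
    fix s assume s: "s \<in> {s\<in>?I. \<gamma> s \<in> nbhd \<delta> S}"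
    then obtain b where b: "b \<in> S" "d b (\<gamma> s) < \<delta>" unfolding nbhd_def by auto
    then have "s \<in> ball s (\<delta> - d b (\<gamma> s))" by simp
    then show "s \<in> U S \<inter> ?I" using s b unfolding U_def by blast
  qed
  have BM: "B \<subseteq> M" and CM: "C \<subseteq> M" using B C unfolding geodesic_segment_def by auto
  have "A \<subseteq> nbhd \<delta> (B \<union> C)"
    using thin A B C unfolding thin_triangles_def geodesic_triangle_def by blast
  then have "\<gamma> s \<in> nbhd \<delta> B \<or> \<gamma> s \<in> nbhd \<delta> C" if "s \<in> ?I" for s
    using that g(3) unfolding nbhd_def by blast
  then have cover: "?I \<subseteq> U B \<union> U C" using U[OF BM] U[OF CM] by blast
  have self: "x \<in> nbhd \<delta> S" if "x \<in> S" "S \<subseteq> M" for x S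
    using that \<open>\<delta> > 0\<close> unfolding nbhd_def by (auto intro!: bexI[of _ x])
  have "d p q \<in> U B"
    using U[OF BM] self[of q B] geodesic_segment_endpoints[OF B] BM g(2) by auto
  moreover have "0 \<in> U C"
    using U[OF CM] self[of p C] geodesic_segment_endpoints[OF C] CM g(1) by auto
  moreover have "0 \<in> ?I" "d p q \<in> ?I" by auto
  ultimately have "U B \<inter> ?I \<noteq> {}" "U C \<inter> ?I \<noteq> {}" by blast+
  then have "U B \<inter> U C \<inter> ?I \<noteq> {}"
    using connectedD[OF connected_Icc opn opn _ cover] by blast
  then obtain s where "s \<in> ?I" "\<gamma> s \<in> nbhd \<delta> B" "\<gamma> s \<in> nbhd \<delta> C"
    using U[OF BM] U[OF CM] by blast
  then show thesis using that g(3) by blast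
qed

text \<open>
  The Gromov product of \<open>x\<close> and \<open>z\<close> based at \<open>w\<close> agrees up to \<open>2 * \<delta>\<close> with the distance of \<open>w\<close>
  from a geodesic between \<open>x\<close> and \<open>z\<close>. A point of that geodesic which is almost closest to \<open>w\<close> is
  \<open>\<delta>\<close>-close to a geodesic from \<open>z\<close> to \<open>y\<close> or from \<open>y\<close> to \<open>x\<close>, which bounds one of the other two
  Gromov products.
\<close>

lemma thin_triangles_imp_four_point:
  assumes thin: "thin_triangles \<delta>" and "\<delta> > 0"
    and geo: "\<And>p q. p \<in> M \<Longrightarrow> q \<in> M \<Longrightarrow> \<exists>S. geodesic_segment S p q"
    and M: "x \<in> M" "y \<in> M" "z \<in> M" "w \<in> M"
  shows "d x z + d y w \<le> max (d x y + d z w) (d x w + d y z) + 6 * \<delta>"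
proof -
  obtain A where A: "geodesic_segment A x z" using geo M by blast
  obtain B where B: "geodesic_segment B z w" using geo M by blast
  obtain C where C: "geodesic_segment C w x" using geo M by blast
  obtain B' where B': "geodesic_segment B' z y" using geo M by blast
  obtain C' where C': "geodesic_segment C' y x" using geo M by blast
  obtain t where t: "t \<in> A" "t \<in> nbhd \<delta> B" "t \<in> nbhd \<delta> C"
    using thin_triangle_center[OF thin \<open>\<delta> > 0\<close> A B C] .
  obtain b c where b: "b \<in> B" "d b t < \<delta>" and c: "c \<in> C" "d c t < \<delta>"
    using t unfolding nbhd_def by auto
  note bt = geodesic_segment_betweenness
  have tM: "t \<in> M" and bM: "b \<in> M" and cM: "c \<in> M" using bt A B C t b c by blast+
  have "d z b + d b w = d z w" "d w c + d c x = d w x" "d x t + d t z = d x z"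
    using bt(2) A B C t b c by blast+
  moreover have "d t w \<le> d b t + d b w" "d t w \<le> d c t + d w c"
    "d t z \<le> d b t + d z b" "d x t \<le> d c t + d c x"
    using triangle[of t b w] triangle[of t c w] triangle[of t b z] triangle[of x c t]
      M tM bM cM commute by (metis add.commute)+
  ultimately have near: "2 * d t w + d x z \<le> d z w + d x w + 4 * \<delta>"
    using b c commute[of w x] by linarith
  have "A \<subseteq> nbhd \<delta> (B' \<union> C')"
    using thin A B' C' unfolding thin_triangles_def geodesic_triangle_def by blast
  then obtain e where e: "e \<in> B' \<or> e \<in> C'" "d e t < \<delta>"
    using t(1) unfolding nbhd_def by fastforce
  have "d z w + d y w \<le> d z y + 2 * (\<delta> + d t w) \<or> d x w + d y w \<le> d x y + 2 * (\<delta> + d t w)"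
  proof -
    have eM: "e \<in> M" using e bt(1) B' C' by blast
    have "d e w \<le> \<delta> + d t w" using triangle[of e t w] e eM tM M by linarith
    moreover have "d z w \<le> d z e + d e w" "d y w \<le> d y e + d e w" "d x w \<le> d x e + d e w"
      using triangle eM M by blast+
    moreover have "d z e + d e y = d z y \<or> d y e + d e x = d y x" using e bt(2) B' C' by blast
    ultimately show ?thesis using commute[of e y] commute[of e x] commute[of x y] by argo
  qed
  then have "d x z + d y w \<le> d x w + d y z + 6 * \<delta> \<or> d x z + d y w \<le> d x y + d z w + 6 * \<delta>"
    using near commute[of y z] by argo
  then show ?thesis by (auto simp: max_def)
qed

end

section \<open>Groups with a left-invariant hyperbolic metric\<close>

text \<open>
  The properties of the word metric of a hyperbolic group that the argument uses. The metric is
  only evaluated on vertices of the Cayley graph, and geodesics are replaced by the existence of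
  vertices at prescribed integral distances.
\<close>

locale hyperbolic_metric_group = group G for G (structure) +
  fixes d :: "'a \<Rightarrow> 'a \<Rightarrow> real" and \<delta> :: real
  assumes d_self: "x \<in> carrier G \<Longrightarrow> d x x = 0"
    and d_commute: "d x y = d y x"
    and d_triangle: "\<lbrakk>x \<in> carrier G; y \<in> carrier G; z \<in> carrier G\<rbrakk> \<Longrightarrow> d x z \<le> d x y + d y z"
    and d_left_inv: "\<lbrakk>g \<in> carrier G; x \<in> carrier G; y \<in> carrier G\<rbrakk>
      \<Longrightarrow> d (g \<otimes> x) (g \<otimes> y) = d x y"
    and finite_ball: "finite {x \<in> carrier G. d \<one> x \<le> r}"
    and geodesic: "\<lbrakk>x \<in> carrier G; y \<in> carrier G; real k \<le> d x y\<rbrakk>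
      \<Longrightarrow> \<exists>p\<in>carrier G. d x p = real k \<and> d p y = d x y - real k"
    and four_point: "\<lbrakk>x \<in> carrier G; y \<in> carrier G; z \<in> carrier G; w \<in> carrier G\<rbrakk>
      \<Longrightarrow> d x z + d y w \<le> max (d x y + d z w) (d x w + d y z) + 2 * \<delta>"
begin

text \<open>The Gromov product of \<open>x\<close> and \<open>y\<close> with respect to the base point \<open>p\<close>.\<close>

definition gp :: "'a \<Rightarrow> 'a \<Rightarrow> 'a \<Rightarrow> real" where
  "gp p x y = (d p x + d p y - d x y) / 2"

lemma d_nonneg: "x \<in> carrier G \<Longrightarrow> y \<in> carrier G \<Longrightarrow> 0 \<le> d x y"
  using d_triangle[of x y x] d_self[of x] d_commute[of x y] by simp

lemma delta_nonneg: "0 \<le> \<delta>"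
  using four_point[of \<one> \<one> \<one> \<one>] d_self[of \<one>] by simp

lemma four_point_le:
  "\<lbrakk>x \<in> carrier G; y \<in> carrier G; z \<in> carrier G; w \<in> carrier G;
    d x y + d z w \<le> r; d x w + d y z \<le> r\<rbrakk> \<Longrightarrow> d x z + d y w \<le> r + 2 * \<delta>"
  using four_point[of x y z w] by simp

lemma d_move: "g \<in> carrier G \<Longrightarrow> x \<in> carrier G \<Longrightarrow> y \<in> carrier G \<Longrightarrow> d (g \<otimes> x) y = d x (inv g \<otimes> y)"
  using d_left_inv[of "inv g" "g \<otimes> x" y] by (simp add: m_assoc[symmetric])

lemma d_inv: "x \<in> carrier G \<Longrightarrow> d \<one> (inv x) = d \<one> x"
  using d_left_inv[of x \<one> "inv x"] d_commute by simp

lemma d_mult_right: "x \<in> carrier G \<Longrightarrow> y \<in> carrier G \<Longrightarrow> d x (x \<otimes> y) = d \<one> y"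
  using d_left_inv[of x \<one> y] by simp

lemma gp_commute: "gp p x y = gp p y x"
  by (simp add: gp_def d_commute)

lemma gp_four_point:
  assumes "p \<in> carrier G" "x \<in> carrier G" "y \<in> carrier G" "z \<in> carrier G"
  shows "min (gp p x y) (gp p y z) \<le> gp p x z + \<delta>"
  using four_point[of x y z p] assms d_commute[of x p] d_commute[of y p] d_commute[of z p]
  unfolding gp_def by (auto simp: min_def max_def field_simps split: if_splits)

lemma gp_left_inv:
  "\<lbrakk>g \<in> carrier G; p \<in> carrier G; x \<in> carrier G; y \<in> carrier G\<rbrakk>
    \<Longrightarrow> gp (g \<otimes> p) (g \<otimes> x) (g \<otimes> y) = gp p x y"
  by (simp add: gp_def d_left_inv)

lemma gp_base_mult:
  "\<lbrakk>g \<in> carrier G; x \<in> carrier G; y \<in> carrier G\<rbrakk> \<Longrightarrow> gp g (g \<otimes> x) (g \<otimes> y) = gp \<one> x y"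
  using gp_left_inv[of g \<one> x y] by simp

lemma gp_nonneg: "\<lbrakk>p \<in> carrier G; x \<in> carrier G; y \<in> carrier G\<rbrakk> \<Longrightarrow> 0 \<le> gp p x y"
  unfolding gp_def using d_triangle[of x p y] d_commute[of x p] by simp

lemma gp_le_left: "\<lbrakk>p \<in> carrier G; x \<in> carrier G; y \<in> carrier G\<rbrakk> \<Longrightarrow> gp p x y \<le> d p x"
  unfolding gp_def using d_triangle[of p x y] by simp

lemma gp_ge_left: "\<lbrakk>p \<in> carrier G; x \<in> carrier G; y \<in> carrier G\<rbrakk> \<Longrightarrow> d p x - d x y \<le> gp p x y"
  unfolding gp_def using d_triangle[of p y x] d_commute[of x y] by simp

lemma gp_swap_base: "gp p x y = d p x - gp x p y"
  unfolding gp_def using d_commute[of x p] by (simp add: field_simps)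

lemma gp_le_gp_left:
  "\<lbrakk>p \<in> carrier G; x \<in> carrier G; x' \<in> carrier G; y \<in> carrier G\<rbrakk> \<Longrightarrow> gp p x y \<le> gp p x' y + d x x'"
  unfolding gp_def using d_triangle[of p x' x] d_triangle[of x' x y] d_commute[of x' x] by (simp add: field_simps)

lemma gp_le_gp_right:
  "\<lbrakk>p \<in> carrier G; x \<in> carrier G; y \<in> carrier G; y' \<in> carrier G\<rbrakk> \<Longrightarrow> gp p x y \<le> gp p x y' + d y y'"
  using gp_le_gp_left[of p y y' x] by (simp add: gp_commute)

lemma gp_le_gp_base:
  "\<lbrakk>p \<in> carrier G; q \<in> carrier G; x \<in> carrier G; y \<in> carrier G\<rbrakk> \<Longrightarrow> gp p x y \<le> gp q x y + d p q"
  unfolding gp_def using d_triangle[of p q x] d_triangle[of p q y] by (simp add: field_simps)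

section \<open>Chains with long steps and small turns\<close>

text \<open>
  If consecutive points are far apart and the Gromov products at the corners are small in
  comparison, a chain does not turn back: the corner seen from the start of the chain is
  almost the corner seen from the preceding point, so each step increases the distance from
  the start.
\<close>

lemma chain_progress:
  fixes p :: "nat \<Rightarrow> 'a"
  assumes carr: "\<And>i. i \<le> N \<Longrightarrow> p i \<in> carrier G"
    and long: "\<And>i. i < N \<Longrightarrow> L \<le> d (p i) (p (Suc i))"
    and turn: "\<And>i. i + 2 \<le> N \<Longrightarrow> gp (p (Suc i)) (p i) (p (Suc (Suc i))) \<le> K"
    and L: "2 * K + 2 * \<delta> < L"
  shows "n + 2 \<le> N \<Longrightarrow> gp (p (Suc n)) (p 0) (p (Suc (Suc n))) \<le> K + \<delta>"
    and "Suc n \<le> N \<Longrightarrow> L + real n * (L - 2 * K - 2 * \<delta>) \<le> d (p 0) (p (Suc n))"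
proof -
  show turn0: "gp (p (Suc n)) (p 0) (p (Suc (Suc n))) \<le> K + \<delta>" if "n + 2 \<le> N" for n
    using that
  proof (induction n)
    case 0
    then show ?case using turn[of 0] delta_nonneg by simp
  next
    case (Suc n)
    have c: "p 0 \<in> carrier G" "p (Suc n) \<in> carrier G" "p (Suc (Suc n)) \<in> carrier G"
      "p (Suc (Suc (Suc n))) \<in> carrier G"
      using carr Suc.prems by auto
    have "gp (p (Suc (Suc n))) (p 0) (p (Suc n)) =
        d (p (Suc (Suc n))) (p (Suc n)) - gp (p (Suc n)) (p 0) (p (Suc (Suc n)))"
      unfolding gp_def using d_commute by (simp add: field_simps)
    then have "gp (p (Suc (Suc n))) (p (Suc n)) (p 0) > K + \<delta>"
      using Suc L long[of "Suc n"] d_commute[of "p (Suc n)"] by (simp add: gp_commute)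
    moreover have "min (gp (p (Suc (Suc n))) (p (Suc n)) (p 0))
        (gp (p (Suc (Suc n))) (p 0) (p (Suc (Suc (Suc n))))) \<le> K + \<delta>"
      using gp_four_point[of "p (Suc (Suc n))" "p (Suc n)" "p 0" "p (Suc (Suc (Suc n)))"]
        c turn[of "Suc n"] Suc.prems by simp
    ultimately show ?case by simp
  qed
  show "L + real n * (L - 2 * K - 2 * \<delta>) \<le> d (p 0) (p (Suc n))" if "Suc n \<le> N"
    using that
  proof (induction n)
    case 0
    then show ?case using long[of 0] by simp
  next
    case (Suc n)
    have "d (p 0) (p (Suc (Suc n))) = d (p 0) (p (Suc n)) + d (p (Suc n)) (p (Suc (Suc n)))
        - 2 * gp (p (Suc n)) (p 0) (p (Suc (Suc n)))"
      unfolding gp_def using d_commute by (simp add: field_simps)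
    then show ?case using Suc turn0[of n] long[of "Suc n"] by (simp add: algebra_simps)
  qed
qed

text \<open>
  If \<open>h\<close> is almost on the way from \<open>\<one>\<close> to \<open>y\<close>, then \<open>g \<otimes> h\<close> is almost on the way from \<open>g\<close>, and
  hence from \<open>\<one>\<close>, to \<open>g \<otimes> y\<close>. If moreover \<open>y\<close> and \<open>g \<otimes> y\<close> leave \<open>\<one>\<close> in the same direction for longer
  than \<open>h\<close>, then \<open>h\<close> and \<open>g \<otimes> h\<close> are points of almost the same path at almost the same distance
  from \<open>\<one>\<close>. Read contrapositively, an initial part \<open>h\<close> of \<open>y\<close> that \<open>g\<close> moves far away bounds the
  Gromov product of \<open>y\<close> and \<open>g \<otimes> y\<close>.
\<close>

lemma displacement_of_prefix:
  assumes c: "h \<in> carrier G" "y \<in> carrier G" "g \<in> carrier G"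
    and prefix: "d \<one> h - \<kappa> \<le> gp \<one> h y" and far: "d \<one> h \<le> gp \<one> y (g \<otimes> y)" and "0 \<le> \<kappa>"
  shows "d h (g \<otimes> h) \<le> 3 * d \<one> g + 2 * \<kappa> + 4 * \<delta>"
proof -
  have "gp \<one> h y = gp g (g \<otimes> h) (g \<otimes> y)" using c by (simp add: gp_base_mult)
  also have "\<dots> \<le> gp \<one> (g \<otimes> y) (g \<otimes> h) + d \<one> g"
    using gp_le_gp_base[of g \<one> "g \<otimes> h" "g \<otimes> y"] c by (simp add: gp_commute d_commute)
  finally have "d \<one> h - \<kappa> - d \<one> g \<le> gp \<one> (g \<otimes> y) (g \<otimes> h)" using prefix by simp
  moreover have "min (gp \<one> h y) (gp \<one> y (g \<otimes> y)) \<le> gp \<one> h (g \<otimes> y) + \<delta>"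
    "min (gp \<one> h (g \<otimes> y)) (gp \<one> (g \<otimes> y) (g \<otimes> h)) \<le> gp \<one> h (g \<otimes> h) + \<delta>"
    using c by (auto intro: gp_four_point)
  moreover have "0 \<le> d \<one> g" using c by (simp add: d_nonneg)
  ultimately have "d \<one> h - \<kappa> - d \<one> g - 2 * \<delta> \<le> gp \<one> h (g \<otimes> h)"
    using prefix far \<open>0 \<le> \<kappa>\<close> delta_nonneg by (simp add: min_def split: if_splits)
  moreover have "d \<one> (g \<otimes> h) \<le> d \<one> g + d \<one> h"
    using d_triangle[of \<one> g "g \<otimes> h"] c d_mult_right[of g h] by simp
  ultimately show ?thesis unfolding gp_def by simp
qed

section \<open>Powers of an element of infinite order\<close>

definition infinite_order :: "'a \<Rightarrow> bool" where
  "infinite_order g \<longleftrightarrow> g \<in> carrier G \<and> (\<forall>n::nat. n > 0 \<longrightarrow> g [^] n \<noteq> \<one>)"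

lemma infinite_order_carrier: "infinite_order g \<Longrightarrow> g \<in> carrier G"
  by (simp add: infinite_order_def)

lemma infinite_order_int_pow_eq_one:
  assumes "infinite_order g" "g [^] (n::int) = \<one>"
  shows "n = 0"
proof (rule ccontr)
  assume n: "n \<noteq> 0"
  have c: "g \<in> carrier G" using assms infinite_order_carrier by blast
  have "g [^] (int (nat \<bar>n\<bar>)) = \<one>"
  proof (cases "n \<ge> 0")
    case False
    then have "g [^] (- n) = inv (g [^] n)" using c by (simp add: int_pow_neg)
    then show ?thesis using False assms(2) by simp
  qed (use assms in simp)
  then have "g [^] (nat \<bar>n\<bar>) = \<one>" by (simp only: int_pow_int)
  moreover have "nat \<bar>n\<bar> > 0" using n by simp
  ultimately show False using assms(1) unfolding infinite_order_def by blast
qed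

lemma infinite_order_pow_inj:
  assumes "infinite_order g" "g [^] (m::int) = g [^] (n::int)"
  shows "m = n"
proof -
  have c: "g \<in> carrier G" using assms infinite_order_carrier by blast
  have "g [^] (m - n) = \<one>" using c assms(2) by (simp add: int_pow_diff)
  then show ?thesis using infinite_order_int_pow_eq_one[OF assms(1)] by force
qed

lemma d_pow:
  assumes "g \<in> carrier G"
  shows "d (g [^] (m::int)) (g [^] (n::int)) = d \<one> (g [^] (n - m))"
proof -
  have "g [^] n = g [^] m \<otimes> g [^] (n - m)"
    using int_pow_mult[OF assms, of m "n - m"] by simp
  then show ?thesis using d_mult_right[of "g [^] m" "g [^] (n - m)"] assms by simp
qed

lemma d_pow_minus: "g \<in> carrier G \<Longrightarrow> d \<one> (g [^] (- n::int)) = d \<one> (g [^] n)"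
  by (simp add: int_pow_neg d_inv)

lemma d_pow_abs: "g \<in> carrier G \<Longrightarrow> d \<one> (g [^] \<bar>n::int\<bar>) = d \<one> (g [^] n)"
  by (cases "n \<ge> 0") (simp_all add: d_pow_minus)

lemma d_pow_triangle:
  "g \<in> carrier G \<Longrightarrow> d \<one> (g [^] (m + n::int)) \<le> d \<one> (g [^] m) + d \<one> (g [^] n)"
  using d_triangle[of \<one> "g [^] m" "g [^] (m + n)"] d_pow[of g m "m + n"] by simp

lemma d_pow_mult_le:
  assumes "g \<in> carrier G"
  shows "d \<one> (g [^] (int k * n)) \<le> real k * d \<one> (g [^] n)"
proof (induction k)
  case 0
  then show ?case using d_self[of \<one>] by simp
next
  case (Suc k)
  then show ?case using d_pow_triangle[OF assms, of n "int k * n"] by (simp add: algebra_simps)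
qed

lemma pow_unbounded:
  assumes "infinite_order g"
  obtains n :: int where "r < d \<one> (g [^] n)"
proof -
  have "inj (\<lambda>n::int. g [^] n)" using infinite_order_pow_inj[OF assms] by (auto intro: injI)
  then have "infinite (range (\<lambda>n::int. g [^] n))" using finite_imageD infinite_UNIV_int by blast
  then have "\<not> range (\<lambda>n::int. g [^] n) \<subseteq> {x \<in> carrier G. d \<one> x \<le> r}"
    using finite_ball finite_subset by blast
  then obtain n :: int where "g [^] n \<notin> {x \<in> carrier G. d \<one> x \<le> r}" by blast
  then have "r < d \<one> (g [^] n)" using infinite_order_carrier[OF assms] by simp
  then show thesis by (rule that)
qed

text \<open>
  The elements \<open>g [^] i\<close> with small \<open>i\<close> barely move the ends of a long geodesic from \<open>\<one>\<close> to
  \<open>g [^] N\<close>. If they also did not shift it along itself, they would move its midpoint \<open>p\<close> by a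
  bounded amount, and the conjugates \<open>inv p \<otimes> g [^] i \<otimes> p\<close> would be more elements of a ball than it
  has. So the length of \<open>g [^] N\<close> changes noticeably within a bounded number of steps.
\<close>

lemma pow_length_increases_nearby:
  assumes g: "infinite_order g" and "0 \<le> B"
  shows "\<exists>I::nat. \<forall>N::int. (\<forall>i\<in>{1..int I}. 2 * d \<one> (g [^] i) + 2 \<le> d \<one> (g [^] N)) \<longrightarrow>
      (\<exists>i::int. i \<noteq> 0 \<and> \<bar>i\<bar> \<le> int I \<and> d \<one> (g [^] N) + B < d \<one> (g [^] (N + i)))"
proof -
  define U where "U = {x \<in> carrier G. d \<one> x \<le> B + 4 * \<delta>}"
  have c: "g \<in> carrier G" using g infinite_order_carrier by blast
  define I where "I = Suc (card U)"
  show ?thesis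
  proof (intro exI[of _ I] allI impI, rule ccontr)
    fix N :: int
    assume far: "\<forall>i\<in>{1..int I}. 2 * d \<one> (g [^] i) + 2 \<le> d \<one> (g [^] N)"
    assume "\<not> (\<exists>i::int. i \<noteq> 0 \<and> \<bar>i\<bar> \<le> int I \<and> d \<one> (g [^] N) + B < d \<one> (g [^] (N + i)))"
    then have flat: "d \<one> (g [^] (N + i)) \<le> d \<one> (g [^] N) + B" if "i \<noteq> 0" "\<bar>i\<bar> \<le> int I" for i
      using that by (metis not_le)
    define k where "k = nat \<lfloor>d \<one> (g [^] N) / 2\<rfloor>"
    have f0: "0 \<le> d \<one> (g [^] N)" using d_nonneg c by simp
    have k: "real k \<le> d \<one> (g [^] N) / 2" "d \<one> (g [^] N) / 2 - 1 \<le> real k"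
      unfolding k_def using f0 by linarith+
    obtain p where p: "p \<in> carrier G" "d \<one> p = real k" "d p (g [^] N) = d \<one> (g [^] N) - real k"
      using geodesic[of \<one> "g [^] N" k] c k f0 by auto
    have small: "d p (g [^] i \<otimes> p) \<le> B + 4 * \<delta>" if i: "i \<in> {1..int I}" for i
    proof -
      define q where "q = g [^] i \<otimes> p"
      have cc: "q \<in> carrier G" "g [^] i \<in> carrier G" "g [^] N \<in> carrier G" "g [^] (N + i) \<in> carrier G"
        using c p q_def by auto
      have gN: "g [^] (N + i) = g [^] i \<otimes> g [^] N" using c by (metis add.commute int_pow_mult)
      have q: "d (g [^] i) q = real k" "d q (g [^] (N + i)) = d \<one> (g [^] N) - real k"
        unfolding q_def gN using c p by (simp_all add: d_mult_right d_left_inv)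
      have e: "d (g [^] i) (g [^] (N + i)) = d \<one> (g [^] N)"
        "d (g [^] N) (g [^] (N + i)) = d \<one> (g [^] i)"
        "d (g [^] i) (g [^] N) = d \<one> (g [^] (N + (- i)))"
        using c by (simp_all add: d_pow)
      have fl: "d \<one> (g [^] (N + i)) \<le> d \<one> (g [^] N) + B"
        "d \<one> (g [^] (N + (- i))) \<le> d \<one> (g [^] N) + B"
        using flat[of i] flat[of "- i"] i by auto
      have fi: "2 * d \<one> (g [^] i) + 2 \<le> d \<one> (g [^] N)" using far i by blast
      have "d q \<one> + d (g [^] i) (g [^] (N + i)) \<le> (real k + d \<one> (g [^] N) + B) + 2 * \<delta>"
        by (rule four_point_le)
          (use cc q fl fi k \<open>0 \<le> B\<close> d_commute[of q "g [^] i"] d_commute[of "g [^] i" \<one>] in simp_all)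
      then have q1: "d q \<one> \<le> real k + B + 2 * \<delta>" using e by simp
      have "d q (g [^] N) + d (g [^] i) (g [^] (N + i)) \<le>
          (2 * d \<one> (g [^] N) - real k + B) + 2 * \<delta>"
        by (rule four_point_le)
          (use cc q e fl fi k \<open>0 \<le> B\<close> d_commute[of q "g [^] i"] in simp_all)
      then have qN: "d q (g [^] N) \<le> d \<one> (g [^] N) - real k + B + 2 * \<delta>" using e by simp
      have "d p q + d \<one> (g [^] N) \<le> (d \<one> (g [^] N) + B + 2 * \<delta>) + 2 * \<delta>"
        by (rule four_point_le)
          (use cc p q1 qN d_commute[of p \<one>] d_commute[of q \<one>] in simp_all)
      then have "d p q \<le> B + 4 * \<delta>" by simp
      then show ?thesis by (simp add: q_def)
    qed
    define F where "F i = inv p \<otimes> (g [^] i \<otimes> p)" for i :: int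
    have "F ` {1..int I} \<subseteq> U"
    proof
      fix x assume "x \<in> F ` {1..int I}"
      then obtain i where i: "i \<in> {1..int I}" "x = F i" by blast
      have "d \<one> (F i) = d p (g [^] i \<otimes> p)"
        unfolding F_def using d_move[of p \<one> "g [^] i \<otimes> p"] c p by simp
      then show "x \<in> U" using small[OF i(1)] i(2) c p by (simp add: U_def F_def)
    qed
    moreover have "inj_on F {1..int I}"
      using infinite_order_pow_inj[OF g] c p by (auto simp: F_def intro!: inj_onI)
    moreover have "finite U" unfolding U_def by (rule finite_ball)
    ultimately have "card {1..int I} \<le> card U" using card_inj_on_le by blast
    then show False by (simp add: I_def)
  qed
qed

text \<open>
  By the four-point inequality the increment of the length from \<open>M\<close> to \<open>M + i\<close> almost does not
  depend on \<open>M\<close>, as long as \<open>g [^] M\<close> is far away, so an increment above \<open>2 * \<delta>\<close> accumulates.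
\<close>

lemma pow_length_grows_linearly_somewhere:
  assumes g: "infinite_order g"
  shows "\<exists>I::nat. \<forall>K::nat. \<exists>i\<in>{1..int I}. real K \<le> d \<one> (g [^] (int K * i))"
proof -
  have c: "g \<in> carrier G" using g infinite_order_carrier by blast
  have B: "0 \<le> 2 * \<delta> + 1" using delta_nonneg by simp
  obtain I :: nat where I: "\<forall>N::int. (\<forall>i\<in>{1..int I}. 2 * d \<one> (g [^] i) + 2 \<le> d \<one> (g [^] N))
      \<longrightarrow> (\<exists>i::int. i \<noteq> 0 \<and> \<bar>i\<bar> \<le> int I \<and> d \<one> (g [^] N) + (2 * \<delta> + 1) < d \<one> (g [^] (N + i)))"
    using pow_length_increases_nearby[OF g B] ..
  define F where "F = (\<Sum>i\<in>{1..int I}. d \<one> (g [^] i))"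
  have F: "d \<one> (g [^] i) \<le> F" if "i \<in> {1..int I}" for i
    unfolding F_def using that c by (intro member_le_sum) (auto simp: d_nonneg)
  have F0: "0 \<le> F" unfolding F_def using c by (intro sum_nonneg) (auto simp: d_nonneg)
  show ?thesis
  proof (intro exI[of _ I] allI)
    fix K :: nat
    \<comment> \<open>so far away that even \<open>K\<close> steps of size at most \<open>F\<close> do not lead back near \<open>\<one>\<close>\<close>
    obtain N :: int where N: "2 * F + 2 + (real K + 1) * F + \<delta> < d \<one> (g [^] N)"
      using pow_unbounded[OF g] .
    have "0 \<le> (real K + 1) * F" using F0 by simp
    then have "\<forall>i\<in>{1..int I}. 2 * d \<one> (g [^] i) + 2 \<le> d \<one> (g [^] N)"
      using N F delta_nonneg by fastforce
    from I[THEN spec, THEN mp, OF this]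
    obtain i :: int where i: "i \<noteq> 0" "\<bar>i\<bar> \<le> int I"
      and step: "d \<one> (g [^] N) + (2 * \<delta> + 1) < d \<one> (g [^] (N + i))"
      by (elim exE conjE)
    have fi: "d \<one> (g [^] i) \<le> F" using F[of "\<bar>i\<bar>"] i c by (simp add: d_pow_abs)
    have grow: "d \<one> (g [^] N) + real k \<le> d \<one> (g [^] (N + int k * i))" if "k \<le> K" for k
      using that
    proof (induction k)
      case (Suc k)
      define M where "M = N + int k * i"
      have M1: "N + int (Suc k) * i = M + i" by (simp add: M_def algebra_simps)
      have ki: "d \<one> (g [^] (int k * i)) \<le> real K * F"
      proof -
        have "d \<one> (g [^] (int k * i)) \<le> real k * d \<one> (g [^] i)" using d_pow_mult_le[OF c] .
        also have "\<dots> \<le> real K * F" using fi Suc.prems c by (intro mult_mono) (auto simp: d_nonneg)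
        finally show ?thesis .
      qed
      have e: "d (g [^] (- i)) (g [^] N) = d \<one> (g [^] (N + i))"
        "d (g [^] M) (g [^] (- i)) = d \<one> (g [^] (M + i))"
        "d (g [^] N) (g [^] M) = d \<one> (g [^] (int k * i))"
        using d_pow[OF c, of "- i" N] d_pow[OF c, of M "- i"] d_pow[OF c, of N M]
          d_pow_minus[OF c, of "M + i"] minus_add_distrib[of M i]
        by (simp_all only: M_def diff_conv_add_uminus minus_minus add_diff_cancel_left' add.commute)
          (simp_all add: add.commute)
      have IH: "d \<one> (g [^] N) + real k \<le> d \<one> (g [^] M)" using Suc by (simp add: M_def)
      show ?case
      proof (rule ccontr)
        assume "\<not> ?case"
        then have s1: "d \<one> (g [^] N) + d (g [^] M) (g [^] (- i)) \<le> 2 * d \<one> (g [^] N) + real k + 1"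
          unfolding M1 by (simp add: e)
        have s2: "d \<one> (g [^] (- i)) + d (g [^] N) (g [^] M) \<le> 2 * d \<one> (g [^] N) + real k + 1"
          using fi ki N F0 delta_nonneg d_pow_minus[OF c, of i] d_nonneg[of \<one> "g [^] N"] c
          by (simp add: e algebra_simps)
        have "d \<one> (g [^] M) + d (g [^] N) (g [^] (- i)) \<le>
            (2 * d \<one> (g [^] N) + real k + 1) + 2 * \<delta>"
          by (rule four_point_le) (use c s1 s2 in simp_all)
        then show False using step IH e(1) d_commute[of "g [^] N" "g [^] (- i)"] by simp
      qed
    qed simp
    have "d \<one> (g [^] (N + int K * i)) \<le> d \<one> (g [^] N) + d \<one> (g [^] (int K * i))"
      using d_pow_triangle[OF c] .
    then have "real K \<le> d \<one> (g [^] (int K * i))" using grow[of K] by simp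
    also have "\<dots> = d \<one> (g [^] (int K * \<bar>i\<bar>))"
      using d_pow_abs[OF c, of "int K * i"] by (simp add: abs_mult)
    finally show "\<exists>i\<in>{1..int I}. real K \<le> d \<one> (g [^] (int K * i))"
      using i by (intro bexI[of _ "\<bar>i\<bar>"]) auto
  qed
qed

text \<open>
  If squaring always added less than \<open>C\<close> to the length, the length of \<open>g [^] (2 ^ j * i)\<close> would grow
  linearly in \<open>j\<close> for each of the finitely many exponents \<open>i\<close> of the previous lemma.
\<close>

lemma pow_square_longer:
  assumes g: "infinite_order g" and "0 \<le> C"
  shows "\<exists>n::nat. n \<ge> 1 \<and> d \<one> (g [^] int n) + C \<le> d \<one> (g [^] (2 * int n))"
proof (rule ccontr)
  assume neg: "\<not> ?thesis"
  have short: "d \<one> (g [^] (2 * n)) \<le> d \<one> (g [^] n) + C" if "n \<ge> 1" for n :: int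
  proof -
    have "\<not> (nat n \<ge> 1 \<and> d \<one> (g [^] int (nat n)) + C \<le> d \<one> (g [^] (2 * int (nat n))))"
      using neg by blast
    moreover have "1 \<le> nat n" using that by simp
    ultimately show ?thesis using that by simp
  qed
  have c: "g \<in> carrier G" using g infinite_order_carrier by blast
  have iter: "d \<one> (g [^] (2 ^ j * i)) \<le> d \<one> (g [^] i) + real j * C" if "i \<ge> 1" for i :: int and j :: nat
  proof (induction j)
    case (Suc j)
    have "1 \<le> 2 ^ j * i" using that by (simp add: int_one_le_iff_zero_less)
    then show ?case using short[of "2 ^ j * i"] Suc by (simp add: mult.assoc algebra_simps)
  qed simp
  obtain I :: nat where I: "\<forall>K::nat. \<exists>i\<in>{1..int I}. real K \<le> d \<one> (g [^] (int K * i))"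
    using pow_length_grows_linearly_somewhere[OF g] ..
  define F where "F = (\<Sum>i\<in>{1..int I}. d \<one> (g [^] i))"
  have F: "d \<one> (g [^] i) \<le> F" if "i \<in> {1..int I}" for i
    unfolding F_def using that c by (intro member_le_sum) (auto simp: d_nonneg)
  have le: "2 ^ j \<le> F + real j * C" for j :: nat
  proof -
    obtain i where "i \<in> {1..int I}" "real (2 ^ j) \<le> d \<one> (g [^] (int (2 ^ j) * i))"
      using I[THEN spec, of "2 ^ j"] by blast
    then show ?thesis using iter[of i j] F[of i] by simp
  qed
  obtain j :: nat where j: "F + 2 * C + 1 < real j" using reals_Archimedean2 by blast
  have "real j < 2 ^ j" by (rule of_nat_less_two_power)
  then have "real j * real j \<le> 2 ^ j * 2 ^ j" by (intro mult_mono) auto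
  also have "\<dots> = 2 ^ (2 * j)" by (simp only: mult_2 power_add)
  also have "\<dots> \<le> F + real (2 * j) * C" by (rule le)
  \<comment> \<open>an elementary contradiction between exponential and linear growth: compare both with \<open>j\<^sup>2\<close>\<close>
  finally have up: "real j * real j \<le> F + real j * (2 * C)" by simp
  have "0 \<le> F" unfolding F_def using c by (intro sum_nonneg) (auto simp: d_nonneg)
  then have "F \<le> real j * F" using j \<open>0 \<le> C\<close> by (intro mult_le_cancel_right1[THEN iffD2]) auto
  then have "real j * real j \<le> real j * (F + 2 * C)" using up by (simp add: algebra_simps)
  then show False using j \<open>0 \<le> C\<close> \<open>0 \<le> F\<close> by simp
qed

text \<open>
  The powers of \<open>w\<close> form a quasi-geodesic line: a discrete axis on which \<open>w\<close> acts as a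
  translation.
\<close>

definition loxodromic :: "'a \<Rightarrow> real \<Rightarrow> bool" where
  "loxodromic w \<kappa> \<longleftrightarrow> w \<in> carrier G \<and> (\<forall>n::nat. real n \<le> d \<one> (w [^] int n)) \<and>
     (\<forall>a b::nat. gp \<one> (w [^] (- int a)) (w [^] int b) \<le> \<kappa>)"

lemma loxodromic_inv:
  assumes "loxodromic w \<kappa>"
  shows "loxodromic (inv w) \<kappa>"
proof -
  have c: "w \<in> carrier G" using assms loxodromic_def by blast
  have p: "inv w [^] n = w [^] (- n)" for n :: int using c by (simp add: int_pow_neg int_pow_inv)
  show ?thesis
    using assms c unfolding loxodromic_def p by (simp add: d_pow_minus gp_commute)
qed

lemma loxodromicD:
  assumes "loxodromic w \<kappa>"
  shows "w \<in> carrier G" "\<bar>real_of_int n\<bar> \<le> d \<one> (w [^] n)" "0 \<le> \<kappa>"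
proof -
  show c: "w \<in> carrier G" using assms loxodromic_def by blast
  have "real (nat \<bar>n\<bar>) \<le> d \<one> (w [^] (int (nat \<bar>n\<bar>)))" using assms loxodromic_def by blast
  then show "\<bar>real_of_int n\<bar> \<le> d \<one> (w [^] n)" using c by (simp add: d_pow_abs)
  have "gp \<one> (w [^] (- int 0)) (w [^] int 0) \<le> \<kappa>" using assms loxodromic_def by blast
  then show "0 \<le> \<kappa>" by (simp add: gp_def d_self)
qed

text \<open>
  Translating the axis along itself, the corner at \<open>w [^] m\<close> between its neighbours on both sides
  becomes a corner at \<open>\<one>\<close>, so \<open>w [^] m\<close> is almost on the way from \<open>\<one>\<close> to \<open>w [^] n\<close>.
\<close>

lemma loxodromic_prefix:
  assumes "loxodromic w \<kappa>" "m \<le> n"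
  shows "d \<one> (w [^] int m) - \<kappa> \<le> gp \<one> (w [^] int m) (w [^] int n)"
proof -
  have c: "w \<in> carrier G" using assms loxodromic_def by blast
  have e: "w [^] int m \<otimes> w [^] (- int m) = \<one>" "w [^] int m \<otimes> w [^] int (n - m) = w [^] int n"
    using c assms(2) by (simp_all flip: int_pow_mult add: of_nat_diff)
  have "gp (w [^] int m) \<one> (w [^] int n) = gp \<one> (w [^] (- int m)) (w [^] int (n - m))"
    using gp_base_mult[of "w [^] int m" "w [^] (- int m)" "w [^] int (n - m)"] c e by simp
  also have "\<dots> \<le> \<kappa>" using assms(1) loxodromic_def by blast
  finally show ?thesis using gp_swap_base[of \<one> "w [^] int m" "w [^] int n"] by simp
qed

text \<open>
  If the square of \<open>w\<close> is noticeably longer than \<open>w\<close>, the powers of \<open>w\<close> form a chain with long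
  steps and small turns.
\<close>

lemma loxodromic_if_square_longer:
  assumes c: "w \<in> carrier G" and longer: "d \<one> w + (3 * \<delta> + 1) \<le> d \<one> (w [^] (2::int))"
  shows "\<exists>\<kappa>. loxodromic w \<kappa>"
proof -
  define K where "K = d \<one> w - d \<one> (w [^] (2::int)) / 2"
  have turnK: "gp u \<one> (u [^] (2::int)) = d \<one> u - d \<one> (u [^] (2::int)) / 2" if "u \<in> carrier G" for u
    unfolding gp_def using that d_pow[of u 1 2] d_commute[of u \<one>] by (simp add: field_simps)
  have K0: "0 \<le> K" using turnK[OF c] gp_nonneg[of w \<one> "w [^] (2::int)"] c by (simp add: K_def)
  have L: "2 * K + 3 * \<delta> + 1 \<le> d \<one> w" using longer unfolding K_def by simp
  \<comment> \<open>to be used for \<open>u = w\<close> and \<open>u = inv w\<close>, which generate the two rays of the axis\<close>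
  have half: "real n \<le> d \<one> (u [^] int n)" "gp \<one> (u [^] (- int (Suc n))) u \<le> K + \<delta>"
    if u: "u \<in> carrier G" "d \<one> u = d \<one> w" "d \<one> (u [^] (2::int)) = d \<one> (w [^] (2::int))"
    for u and n :: nat
  proof -
    define p where "p i = u [^] int i" for i :: nat
    have p0: "p 0 = \<one>" by (simp add: p_def)
    have pc: "p i \<in> carrier G" for i using u by (simp add: p_def)
    have step: "d \<one> w \<le> d (p i) (p (Suc i))" for i using u by (simp add: p_def d_pow)
    have turn: "gp (p (Suc i)) (p i) (p (Suc (Suc i))) \<le> K" for i
    proof -
      have "p (Suc i) = p i \<otimes> u" "p (Suc (Suc i)) = p i \<otimes> u [^] (2::int)" "p i = p i \<otimes> \<one>"
        unfolding p_def using u int_pow_mult[of u "int i" 1] int_pow_mult[of u "int i" 2]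
        by (simp_all add: add.commute)
      then show ?thesis
        using gp_left_inv[of "p i" u \<one> "u [^] (2::int)"] turnK[OF u(1)] u pc by (simp add: K_def)
    qed
    have lt: "2 * K + 2 * \<delta> < d \<one> w" using L delta_nonneg by simp
    show "real n \<le> d \<one> (u [^] int n)"
    proof (cases n)
      case 0
      then show ?thesis by (simp add: d_self)
    next
      case (Suc m)
      have "real m * 1 \<le> real m * (d \<one> w - 2 * K - 2 * \<delta>)"
        using L delta_nonneg by (intro mult_left_mono) auto
      then have "1 + real m \<le> d \<one> w + real m * (d \<one> w - 2 * K - 2 * \<delta>)"
        using L K0 delta_nonneg by simp
      also have "\<dots> \<le> d (p 0) (p (Suc m))"
        using chain_progress(2)[of n p "d \<one> w" K m, OF pc step turn lt] Suc by simp
      finally show ?thesis using Suc by (simp add: p0 p_def)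
    qed
    have "p (Suc n) \<otimes> u [^] (- int (Suc n)) = \<one>" "p (Suc n) \<otimes> u = p (Suc (Suc n))"
      unfolding p_def using u int_pow_mult[of u "int (Suc n)" "- int (Suc n)"]
        int_pow_mult[of u "int (Suc n)" 1]
      by (simp_all add: add.commute)
    then have "gp \<one> (u [^] (- int (Suc n))) u = gp (p (Suc n)) (p 0) (p (Suc (Suc n)))"
      using gp_base_mult[of "p (Suc n)" "u [^] (- int (Suc n))" u] pc u p0 by simp
    also have "\<dots> \<le> K + \<delta>"
      using chain_progress(1)[of "n + 2" p "d \<one> w" K n, OF pc step turn lt] by simp
    finally show "gp \<one> (u [^] (- int (Suc n))) u \<le> K + \<delta>" .
  qed
  have inv_pow: "inv w [^] n = w [^] (- n)" for n :: int using c by (simp add: int_pow_neg int_pow_inv)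
  have inv: "inv w \<in> carrier G" "d \<one> (inv w) = d \<one> w" "d \<one> (inv w [^] (2::int)) = d \<one> (w [^] (2::int))"
    using c by (simp_all add: d_inv int_pow_inv)
  have two: "gp \<one> (w [^] (- int a)) (w [^] int b) \<le> K + 2 * \<delta>" for a b :: nat
  proof (cases "a = 0 \<or> b = 0")
    case True
    have "gp \<one> (w [^] (- int a)) (w [^] int b) \<le> d \<one> (w [^] (- int a))"
      using gp_le_left c by simp
    moreover have "gp \<one> (w [^] (- int a)) (w [^] int b) \<le> d \<one> (w [^] int b)"
      using gp_le_left[of \<one> "w [^] int b" "w [^] (- int a)"] c by (simp add: gp_commute)
    ultimately show ?thesis using True K0 delta_nonneg by (auto simp: d_self)
  next
    case False
    then obtain a' b' where ab: "a = Suc a'" "b = Suc b'" by (auto simp: gr0_conv_Suc)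
    have turn: "gp \<one> (w [^] (- int a)) w \<le> K + \<delta>" using half(2)[OF c, of a'] ab by simp
    have "gp w \<one> (w [^] int b) \<le> K + \<delta>"
    proof (cases b')
      case 0
      then show ?thesis
        using ab c K0 delta_nonneg by (simp add: gp_def d_self d_commute)
    next
      case (Suc b'')
      have "w \<otimes> w [^] int b' = w [^] int b"
        using c ab int_pow_mult[of w 1 "int b'"] by simp
      then have "gp w \<one> (w [^] int b) = gp \<one> (inv w) (w [^] int b')"
        using gp_base_mult[of w "inv w" "w [^] int b'"] c by simp
      also have "\<dots> = gp \<one> (inv w [^] (- int (Suc b''))) (inv w)"
        using Suc inv_pow[of "- int b'"] by (simp add: gp_commute add.commute)
      also have "\<dots> \<le> K + \<delta>" using half(2)[OF inv] .
      finally show ?thesis .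
    qed
    then have "K + 2 * \<delta> < gp \<one> w (w [^] int b)"
      using gp_swap_base[of \<one> w "w [^] int b"] L by simp
    moreover have "min (gp \<one> (w [^] (- int a)) (w [^] int b)) (gp \<one> (w [^] int b) w) \<le> K + 2 * \<delta>"
      using gp_four_point[of \<one> "w [^] (- int a)" "w [^] int b" w] turn c by simp
    ultimately show ?thesis by (simp add: gp_commute)
  qed
  show ?thesis
    using c half(1)[OF c] two unfolding loxodromic_def by blast
qed

theorem infinite_order_imp_loxodromic_power:
  assumes g: "infinite_order g"
  obtains n :: nat and \<kappa> where "n \<ge> 1" "loxodromic (g [^] int n) \<kappa>"
proof -
  have c: "g \<in> carrier G" using g infinite_order_carrier by blast
  obtain n :: nat where n: "n \<ge> 1" "d \<one> (g [^] int n) + (3 * \<delta> + 1) \<le> d \<one> (g [^] (2 * int n))"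
    using pow_square_longer[OF g, of "3 * \<delta> + 1"] delta_nonneg by auto
  have "(g [^] int n) [^] (2::int) = g [^] (2 * int n)"
    using int_pow_pow[OF c, of "int n" 2] by (simp add: mult.commute)
  then have "\<exists>\<kappa>. loxodromic (g [^] int n) \<kappa>"
    using loxodromic_if_square_longer[of "g [^] int n"] n c by simp
  then show thesis using that n by blast
qed

section \<open>Commensurators of cyclic subgroups\<close>

lemma loxodromic_imp_infinite_order:
  assumes "loxodromic w \<kappa>"
  shows "infinite_order w"
  unfolding infinite_order_def
proof (intro conjI allI impI)
  show "w \<in> carrier G" using loxodromicD(1)[OF assms] .
  fix n :: nat assume n: "n > 0"
  show "w [^] n \<noteq> \<one>"
  proof
    assume "w [^] n = \<one>"
    then have "w [^] int n = \<one>" by (simp only: int_pow_int)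
    then show False using loxodromicD(2)[OF assms, of "int n"] n d_self[of \<one>] by simp
  qed
qed

lemma commute_int_pow:
  assumes "w \<in> carrier G" "c \<in> carrier G" "c \<otimes> w [^] int k = w [^] int k \<otimes> c"
  shows "c \<otimes> w [^] int (k * m) = w [^] int (k * m) \<otimes> c"
    and "c \<otimes> w [^] (- int (k * m)) = w [^] (- int (k * m)) \<otimes> c"
proof -
  have e: "w [^] int (k * m) = (w [^] int k) [^] m"
    using int_pow_pow[OF assms(1), of "int k" "int m"] by (simp add: int_pow_int flip: of_nat_mult)
  show *: "c \<otimes> w [^] int (k * m) = w [^] int (k * m) \<otimes> c"
    unfolding e using group_commutes_pow[of "w [^] int k" c m] assms by simp
  define a where "a = w [^] int (k * m)"
  have a: "a \<in> carrier G" "w [^] (- int (k * m)) = inv a"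
    using assms(1) by (simp_all add: a_def int_pow_neg)
  have ca: "c \<otimes> a = a \<otimes> c" using * by (simp add: a_def)
  have "inv a \<otimes> c = inv a \<otimes> (c \<otimes> a) \<otimes> inv a" using a(1) assms(2) by (simp add: m_assoc)
  also have "\<dots> = c \<otimes> inv a" unfolding ca using a(1) assms(2) by (simp flip: m_assoc)
  finally show "c \<otimes> w [^] (- int (k * m)) = w [^] (- int (k * m)) \<otimes> c" unfolding a by simp
qed

text \<open>
  If \<open>c\<close> commutes with a power of \<open>w\<close>, translation by \<open>c\<close> moves arbitrarily distant points of the
  axis in both directions by the bounded amount \<open>d \<one> c\<close>. Seen from \<open>\<one>\<close>, the ends of the axis and
  of its translate agree, so \<open>\<one>\<close> is almost between the ends of the translated axis, hence close
  to the point of that axis at which the direction seen from \<open>\<one>\<close> changes from one end to the other.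
  The bound does not depend on \<open>c\<close>.
\<close>

lemma translate_of_axis_close:
  assumes lox: "loxodromic w \<kappa>" and c: "c \<in> carrier G"
    and k: "k \<ge> 1" and comm: "c \<otimes> w [^] int k = w [^] int k \<otimes> c"
  shows "\<exists>j::int. d \<one> (c \<otimes> w [^] j) \<le> 3 * \<kappa> + 6 * \<delta> + d \<one> w"
proof -
  note w = loxodromicD(1)[OF lox] and \<kappa> = loxodromicD(3)[OF lox]
  obtain m :: nat where m: "d \<one> c + \<kappa> + 3 * \<delta> < real m" using reals_Archimedean2 by blast
  define n where "n = k * m"
  have "m \<le> n" using k by (simp add: n_def)
  then have n: "d \<one> c + \<kappa> + 3 * \<delta> < real n" using m by simp
  define W where "W j = w [^] (j :: int)" for j
  have Wc: "W j \<in> carrier G" for j using w by (simp add: W_def)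
  have com: "c \<otimes> W (int n) = W (int n) \<otimes> c" "c \<otimes> W (- int n) = W (- int n) \<otimes> c"
    using commute_int_pow[OF w c comm, of m] by (simp_all add: W_def n_def)
  have Wn: "real n \<le> d \<one> (W (int n))" "real n \<le> d \<one> (W (- int n))"
    using loxodromicD(2)[OF lox, of "int n"] loxodromicD(2)[OF lox, of "- int n"]
    by (simp_all add: W_def)
  define A where "A = c \<otimes> W (- int n)"
  define B where "B = c \<otimes> W (int n)"
  have AB: "A \<in> carrier G" "B \<in> carrier G" using c Wc by (simp_all add: A_def B_def)
  have dA: "d (W (- int n)) A = d \<one> c" and dB: "d (W (int n)) B = d \<one> c"
    unfolding A_def B_def com using Wc c by (simp_all add: d_mult_right)
  have "\<kappa> + 3 * \<delta> < gp \<one> (W (- int n)) A" "\<kappa> + 3 * \<delta> < gp \<one> (W (int n)) B"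
    using gp_ge_left[of \<one> "W (- int n)" A] gp_ge_left[of \<one> "W (int n)" B] Wc AB dA dB Wn n
    by simp_all
  moreover have "gp \<one> (W (- int n)) (W (int n)) \<le> \<kappa>"
    using lox unfolding loxodromic_def W_def by blast
  moreover have "min (gp \<one> (W (- int n)) A) (gp \<one> A (W (int n))) \<le> gp \<one> (W (- int n)) (W (int n)) + \<delta>"
    "min (gp \<one> A B) (gp \<one> B (W (int n))) \<le> gp \<one> A (W (int n)) + \<delta>"
    using Wc AB by (simp_all add: gp_four_point)
  ultimately have gAB: "gp \<one> A B \<le> \<kappa> + 2 * \<delta>"
    using delta_nonneg gp_commute[of \<one> B "W (int n)"] by (simp add: min_def split: if_splits)
  \<comment> \<open>walk along the translated axis from \<open>A\<close> to \<open>B\<close> until the direction seen from \<open>\<one>\<close> is no longer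
    that of \<open>A\<close>; just before, it is not yet that of \<open>B\<close>\<close>
  define x where "x i = c \<otimes> W (int i - int n)" for i :: nat
  have xc: "x i \<in> carrier G" for i using c Wc by (simp add: x_def)
  have x0: "x 0 = A" "x (2 * n) = B" by (simp_all add: x_def A_def B_def)
  have "d \<one> (W (- int n)) \<le> d \<one> A + d A (W (- int n))" using d_triangle AB Wc by simp
  then have "real n - d \<one> c \<le> d \<one> A" using Wn dA d_commute[of A] by simp
  moreover have "gp \<one> A A = d \<one> A" using AB by (simp add: gp_def d_self)
  ultimately have "\<not> gp \<one> A (x 0) \<le> \<kappa> + 3 * \<delta>" using n by (simp add: x0)
  moreover have "gp \<one> A (x (2 * n)) \<le> \<kappa> + 3 * \<delta>" using gAB delta_nonneg by (simp add: x0)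
  ultimately obtain i where i: "i < 2 * n" "\<not> gp \<one> A (x i) \<le> \<kappa> + 3 * \<delta>"
      "gp \<one> A (x (Suc i)) \<le> \<kappa> + 3 * \<delta>"
    using ex_least_nat_less[of "\<lambda>i. gp \<one> A (x i) \<le> \<kappa> + 3 * \<delta>" "2 * n"] by blast
  have "min (gp \<one> A (x i)) (gp \<one> (x i) B) \<le> gp \<one> A B + \<delta>" using AB xc by (simp add: gp_four_point)
  then have "gp \<one> (x i) B \<le> \<kappa> + 3 * \<delta>" using i(2) gAB by (simp add: min_def split: if_splits)
  moreover have "d (x (Suc i)) (x i) = d \<one> w"
  proof -
    have "x (Suc i) = x i \<otimes> w"
      unfolding x_def W_def using w c int_pow_mult[of w "int i - int n" 1]
      by (simp add: m_assoc algebra_simps)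
    then show ?thesis using xc w d_mult_right d_commute by simp
  qed
  ultimately have xB: "gp \<one> (x (Suc i)) B \<le> \<kappa> + 3 * \<delta> + d \<one> w"
    using gp_le_gp_left[of \<one> "x (Suc i)" "x i" B] xc AB by simp
  have "gp (x (Suc i)) A B \<le> \<kappa>"
  proof -
    have "A = x (Suc i) \<otimes> W (- int (Suc i))" "B = x (Suc i) \<otimes> W (int (2 * n - Suc i))"
      unfolding A_def B_def x_def W_def using c w i(1)
      by (simp_all add: m_assoc of_nat_diff flip: int_pow_mult)
    then have "gp (x (Suc i)) A B = gp \<one> (W (- int (Suc i))) (W (int (2 * n - Suc i)))"
      using gp_base_mult xc Wc by simp
    also have "\<dots> \<le> \<kappa>" using lox unfolding loxodromic_def W_def by blast
    finally show ?thesis .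
  qed
  moreover have "0 \<le> gp \<one> A B" using AB by (simp add: gp_nonneg)
  moreover have "d \<one> (x (Suc i)) + gp \<one> A B =
      gp \<one> A (x (Suc i)) + gp \<one> (x (Suc i)) B + gp (x (Suc i)) A B"
    unfolding gp_def using d_commute[of "x (Suc i)"] by (simp add: field_simps)
  ultimately have "d \<one> (x (Suc i)) \<le> 3 * \<kappa> + 6 * \<delta> + d \<one> w" using i(3) xB by simp
  then show ?thesis unfolding x_def W_def by blast
qed

abbreviation powers :: "'a \<Rightarrow> 'a set" where
  "powers w \<equiv> range (\<lambda>j::int. w [^] j)"

lemma powers_subgroup: "w \<in> carrier G \<Longrightarrow> subgroup (powers w) G"
  using generate_pow[of w] generate_is_subgroup[of "{w}"] by (simp add: full_SetCompr_eq)

text \<open>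
  By \<open>translate_of_axis_close\<close>, applied to the inverse, every element of the commensurator is an
  element of a fixed ball, inverted and multiplied from the left by a power of \<open>w\<close>.
\<close>

lemma commensurator_finite_index:
  assumes lox: "loxodromic w \<kappa>"
  obtains T where "finite T" "T \<subseteq> carrier G"
    "{c \<in> carrier G. \<exists>k\<ge>1. c \<otimes> w [^] int k = w [^] int k \<otimes> c} \<subseteq> (\<Union>t\<in>T. powers w #> t)"
proof -
  note w = loxodromicD(1)[OF lox]
  define T where "T = (\<lambda>r. inv r) ` {x \<in> carrier G. d \<one> x \<le> 3 * \<kappa> + 6 * \<delta> + d \<one> w}"
  show thesis
  proof (rule that[of T])
    show "finite T" unfolding T_def by (intro finite_imageI finite_ball)
    show "T \<subseteq> carrier G" unfolding T_def by auto
    show "{c \<in> carrier G. \<exists>k\<ge>1. c \<otimes> w [^] int k = w [^] int k \<otimes> c} \<subseteq> (\<Union>t\<in>T. powers w #> t)"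
    proof (clarify)
      fix c and k :: nat
      assume c: "c \<in> carrier G" and k: "1 \<le> k" and comm: "c \<otimes> w [^] int k = w [^] int k \<otimes> c"
      define b where "b = w [^] int k"
      have b: "b \<in> carrier G" using w by (simp add: b_def)
      have "inv c \<otimes> b = inv c \<otimes> (b \<otimes> c) \<otimes> inv c" using b c by (simp add: m_assoc)
      also have "\<dots> = inv c \<otimes> (c \<otimes> b) \<otimes> inv c" using comm by (simp add: b_def)
      also have "\<dots> = b \<otimes> inv c" using b c by (simp flip: m_assoc)
      finally obtain j :: int where j: "d \<one> (inv c \<otimes> w [^] j) \<le> 3 * \<kappa> + 6 * \<delta> + d \<one> w"
        using translate_of_axis_close[OF lox _ k, of "inv c"] c unfolding b_def by blast
      then have "inv (inv c \<otimes> w [^] j) \<in> T" unfolding T_def using c w by blast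
      moreover have "c = w [^] j \<otimes> inv (inv c \<otimes> w [^] j)"
        using c w by (simp add: inv_mult_group m_assoc[symmetric])
      ultimately show "c \<in> (\<Union>t\<in>T. powers w #> t)" unfolding r_coset_def by blast
    qed
  qed
qed

end

section \<open>Coverings of a group by cosets\<close>

context group
begin

lemma finite_rcosets_if_finite_covering:
  assumes "subgroup H G" "finite T" "T \<subseteq> carrier G" "carrier G \<subseteq> (\<Union>t\<in>T. H #> t)"
  shows "finite (rcosets H)"
proof -
  have "rcosets H \<subseteq> (\<lambda>t. H #> t) ` T"
  proof
    fix R assume "R \<in> rcosets H"
    then obtain a where a: "a \<in> carrier G" "R = H #> a" unfolding RCOSETS_def by blast
    then obtain t where t: "t \<in> T" "a \<in> H #> t" using assms(4) by blast
    then have "H #> t = H #> a" using repr_independence assms(1,3) by blast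
    then show "R \<in> (\<lambda>t. H #> t) ` T" using a t by blast
  qed
  then show ?thesis using assms(2) finite_surj by blast
qed

text \<open>
  Neumann's lemma. If \<open>H\<close> has infinite index, some coset of \<open>H\<close> is not among the covering ones
  and is therefore covered by cosets of the other subgroups. Translating this covering, every
  coset of \<open>H\<close> can be replaced by finitely many cosets of the other subgroups.
\<close>

lemma coset_covering_finite_index:
  assumes "finite S" "\<And>H. H \<in> S \<Longrightarrow> subgroup H G" "finite T" "T \<subseteq> carrier G"
    "carrier G \<subseteq> (\<Union>H\<in>S. \<Union>t\<in>T. H #> t)"
  shows "\<exists>H\<in>S. finite (rcosets H)"
  using assms
proof (induction S arbitrary: T rule: finite_induct)
  case empty
  then show ?case using one_closed by auto
next
  case (insert H S)
  have H: "subgroup H G" using insert.prems by simp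
  show ?case
  proof (cases "carrier G \<subseteq> (\<Union>t\<in>T. H #> t)")
    case True
    then show ?thesis using finite_rcosets_if_finite_covering[OF H] insert.prems by blast
  next
    case False
    then obtain x where x: "x \<in> carrier G" "x \<notin> (\<Union>t\<in>T. H #> t)" by blast
    define T' where "T' = T \<union> (\<lambda>(t, t'). t \<otimes> (inv x \<otimes> t')) ` (T \<times> T)"
    have "finite T'" "T' \<subseteq> carrier G" using insert.prems x by (auto simp: T'_def)
    moreover have "carrier G \<subseteq> (\<Union>H\<in>S. \<Union>t\<in>T'. H #> t)"
    proof
      fix y assume y: "y \<in> carrier G"
      show "y \<in> (\<Union>H\<in>S. \<Union>t\<in>T'. H #> t)"
      proof (cases "y \<in> (\<Union>H\<in>S. \<Union>t\<in>T. H #> t)")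
        case True
        then show ?thesis by (auto simp: T'_def)
      next
        case False
        moreover have "y \<in> (\<Union>H\<in>insert H S. \<Union>t\<in>T. H #> t)" using insert.prems(4) y by (rule subsetD)
        ultimately have "\<exists>t\<in>T. y \<in> H #> t" by blast
        then obtain t where t: "t \<in> T" "y \<in> H #> t" by blast
        obtain h where h: "t \<in> T" "h \<in> H" "y = h \<otimes> t"
          using t unfolding r_coset_def by blast
        have hc: "h \<in> carrier G" "t \<in> carrier G"
          using subgroup.mem_carrier[OF H h(2)] h(1) insert.prems(3) by auto
        have "h \<otimes> x \<notin> H #> t'" if t': "t' \<in> T" for t'
        proof
          assume "h \<otimes> x \<in> H #> t'"
          then obtain h' where h': "h' \<in> H" "h \<otimes> x = h' \<otimes> t'" unfolding r_coset_def by blast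
          have "h' \<in> carrier G" "t' \<in> carrier G"
            using subgroup.mem_carrier[OF H h'(1)] t' insert.prems(3) by auto
          then have "inv h \<otimes> (h \<otimes> x) = (inv h \<otimes> h') \<otimes> t'"
            unfolding h'(2) using hc by (simp add: m_assoc)
          then have "x = (inv h \<otimes> h') \<otimes> t'" using hc x by (simp flip: m_assoc)
          moreover have "inv h \<otimes> h' \<in> H"
            using H h h' by (simp add: subgroup.m_closed subgroup.m_inv_closed)
          ultimately show False using x t' unfolding r_coset_def by blast
        qed
        moreover have "h \<otimes> x \<in> (\<Union>H\<in>insert H S. \<Union>t\<in>T. H #> t)"
          by (rule subsetD[OF insert.prems(4)]) (use hc x in simp)
        ultimately obtain H' t' where "H' \<in> S" "t' \<in> T" "h \<otimes> x \<in> H' #> t'" by auto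
        then obtain h' where h': "H' \<in> S" "t' \<in> T" "h' \<in> H'" "h \<otimes> x = h' \<otimes> t'"
          unfolding r_coset_def by auto
        have h'c: "h' \<in> carrier G" "t' \<in> carrier G"
          using subgroup.mem_carrier[OF insert.prems(1) h'(3)] h'(1,2) insert.prems(3) by auto
        have "x \<otimes> (inv x \<otimes> t) = t" using hc x by (simp flip: m_assoc)
        then have "y = (h \<otimes> x) \<otimes> (inv x \<otimes> t)" using h(3) hc x by (simp add: m_assoc)
        also have "\<dots> = h' \<otimes> (t' \<otimes> (inv x \<otimes> t))"
          using h'(4) h'c hc x by (simp add: m_assoc)
        finally have "y \<in> H' #> (t' \<otimes> (inv x \<otimes> t))" using h'(3) unfolding r_coset_def by blast
        moreover have "t' \<otimes> (inv x \<otimes> t) \<in> T'" using h' h by (auto simp: T'_def)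
        ultimately show ?thesis using h'(1) by blast
      qed
    qed
    ultimately show ?thesis using insert.IH[of T'] insert.prems(1) by blast
  qed
qed

end

section \<open>Elements in general position\<close>

context hyperbolic_metric_group
begin

text \<open>
  If \<open>w [^] n\<close> and \<open>e \<otimes> w [^] n\<close> stayed together for long, \<open>e\<close> would move a long initial part of the
  axis by a bounded amount, and by the pigeonhole principle two of the conjugates
  \<open>inv (w [^] m) \<otimes> e \<otimes> w [^] m\<close> would coincide.
\<close>

lemma ray_diverges_from_translate:
  assumes lox: "loxodromic w \<kappa>" and e: "e \<in> carrier G"
    and ncomm: "\<And>k::nat. k \<ge> 1 \<Longrightarrow> e \<otimes> w [^] int k \<noteq> w [^] int k \<otimes> e"
  shows "\<exists>K. \<forall>n::nat. gp \<one> (w [^] int n) (e \<otimes> w [^] int n) \<le> K"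
proof -
  note w = loxodromicD(1)[OF lox] and \<kappa> = loxodromicD(3)[OF lox]
  define U where "U = {x \<in> carrier G. d \<one> x \<le> 3 * d \<one> e + 2 * \<kappa> + 4 * \<delta>}"
  define W where "W m = w [^] int m" for m
  have Wc: "W m \<in> carrier G" for m using w by (simp add: W_def)
  define F where "F m = inv (W m) \<otimes> (e \<otimes> W m)" for m
  define K where "K = (\<Sum>m\<le>card U. d \<one> (W m))"
  have K: "d \<one> (W m) \<le> K" if "m \<le> card U" for m
    unfolding K_def using that Wc by (intro member_le_sum) (auto simp: d_nonneg)
  have "gp \<one> (W n) (e \<otimes> W n) \<le> K" for n
  proof (rule ccontr)
    assume far: "\<not> gp \<one> (W n) (e \<otimes> W n) \<le> K"
    have "gp \<one> (W n) (e \<otimes> W n) \<le> d \<one> (W n)" using Wc e by (simp add: gp_le_left)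
    then have n: "card U < n" using far K[of n] by (cases "n \<le> card U") auto
    have "F m \<in> U" if m: "m \<le> card U" for m
    proof -
      have "d \<one> (W m) - \<kappa> \<le> gp \<one> (W m) (W n)"
        unfolding W_def using m n by (intro loxodromic_prefix[OF lox]) simp
      then have "d (W m) (e \<otimes> W m) \<le> 3 * d \<one> e + 2 * \<kappa> + 4 * \<delta>"
        using Wc e far K[OF m] \<kappa> by (intro displacement_of_prefix) auto
      moreover have "d (W m) (e \<otimes> W m) = d \<one> (F m)"
        using d_move[of "W m" \<one> "e \<otimes> W m"] Wc e by (simp add: F_def)
      ultimately show ?thesis using Wc e by (simp add: U_def F_def)
    qed
    then have "F ` {..card U} \<subseteq> U" by blast
    moreover have "finite U" unfolding U_def by (rule finite_ball)
    moreover have "inj_on F {..card U}"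
    proof (rule linorder_inj_onI)
      fix m m' :: nat assume lt: "m < m'"
      define b where "b = w [^] int (m' - m)"
      have b: "b \<in> carrier G" using w by (simp add: b_def)
      have "W m' = b \<otimes> W m"
        unfolding W_def b_def using w lt by (simp flip: int_pow_mult add: of_nat_diff)
      then have F': "F m' = inv (W m) \<otimes> ((inv b \<otimes> (e \<otimes> b)) \<otimes> W m)"
        using b Wc e by (simp add: F_def inv_mult_group m_assoc)
      show "F m \<noteq> F m'"
      proof
        assume "F m = F m'"
        then have "e = inv b \<otimes> (e \<otimes> b)"
          using F' b Wc e by (simp add: F_def)
        then have "b \<otimes> e = b \<otimes> (inv b \<otimes> (e \<otimes> b))" by simp
        also have "\<dots> = e \<otimes> b" using b e by (simp flip: m_assoc)
        finally have "e \<otimes> b = b \<otimes> e" ..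
        moreover have "1 \<le> m' - m" using lt by simp
        ultimately show False using ncomm unfolding b_def by blast
      qed
    qed auto
    ultimately have "card {..card U} \<le> card U" using card_inj_on_le by blast
    then show False by simp
  qed
  then show ?thesis unfolding W_def by blast
qed

lemma axis_diverges_from_translate:
  assumes lox: "loxodromic w \<kappa>" and e: "e \<in> carrier G"
    and ncomm: "\<And>k::nat. k \<ge> 1 \<Longrightarrow> e \<otimes> w [^] int k \<noteq> w [^] int k \<otimes> e"
  shows "\<exists>K. \<forall>n::int. gp \<one> (w [^] n) (e \<otimes> w [^] n) \<le> K"
proof -
  note w = loxodromicD(1)[OF lox]
  have ip: "inv w [^] n = w [^] (- n)" for n :: int using w by (simp add: int_pow_neg int_pow_inv)
  have "e \<otimes> inv w [^] int k \<noteq> inv w [^] int k \<otimes> e" if "k \<ge> 1" for k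
  proof
    assume "e \<otimes> inv w [^] int k = inv w [^] int k \<otimes> e"
    then have "e \<otimes> inv w [^] (- int (k * 1)) = inv w [^] (- int (k * 1)) \<otimes> e"
      using commute_int_pow(2)[of "inv w" e k 1] w e by simp
    then show False using ncomm[OF that] by (simp add: ip)
  qed
  then obtain K' where K': "\<forall>n::nat. gp \<one> (inv w [^] int n) (e \<otimes> inv w [^] int n) \<le> K'"
    using ray_diverges_from_translate[OF loxodromic_inv[OF lox] e] by blast
  obtain K where K: "\<forall>n::nat. gp \<one> (w [^] int n) (e \<otimes> w [^] int n) \<le> K"
    using ray_diverges_from_translate[OF lox e ncomm] by blast
  have "gp \<one> (w [^] n) (e \<otimes> w [^] n) \<le> max K K'" for n :: int
  proof (cases "n \<ge> 0")
    case True
    then show ?thesis using K[THEN spec, of "nat n"] by simp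
  next
    case False
    then show ?thesis using K'[THEN spec, of "nat (- n)"] by (simp add: ip)
  qed
  then show ?thesis by blast
qed

text \<open>
  Elements conjugating \<open>g\<close> to a given element form a coset of the centraliser of \<open>g\<close>, and only
  finitely many elements are short.
\<close>

lemma boundedly_displaced_finite_cosets:
  assumes g: "infinite_order g"
  shows "\<exists>w T. infinite_order w \<and> finite T \<and> T \<subseteq> carrier G \<and>
    {h \<in> carrier G. d h (g \<otimes> h) \<le> C} \<subseteq> (\<Union>t\<in>T. powers w #> t)"
proof -
  have gc: "g \<in> carrier G" using g infinite_order_carrier by blast
  obtain n :: nat and \<kappa> where n: "n \<ge> 1" and lox: "loxodromic (g [^] int n) \<kappa>"
    using infinite_order_imp_loxodromic_power[OF g] .
  define w where "w = g [^] int n"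
  have w: "w \<in> carrier G" using gc by (simp add: w_def)
  obtain T where T: "finite T" "T \<subseteq> carrier G"
    "{c \<in> carrier G. \<exists>k\<ge>1. c \<otimes> w [^] int k = w [^] int k \<otimes> c} \<subseteq> (\<Union>t\<in>T. powers w #> t)"
    using commensurator_finite_index[OF lox] unfolding w_def .
  define U where "U = {x \<in> carrier G. d \<one> x \<le> C}"
  \<comment> \<open>one element conjugating \<open>g\<close> to \<open>b\<close>, meaningless for other \<open>b\<close>\<close>
  define rep where "rep b = (SOME h. h \<in> carrier G \<and> inv h \<otimes> (g \<otimes> h) = b)" for b
  define T' where "T' = (\<lambda>(t, b). t \<otimes> rep b) ` (T \<times> {b \<in> U. rep b \<in> carrier G})"
  have "finite U" unfolding U_def by (rule finite_ball)
  then have "finite T'" "T' \<subseteq> carrier G" using T by (auto simp: T'_def)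
  moreover have "{h \<in> carrier G. d h (g \<otimes> h) \<le> C} \<subseteq> (\<Union>t\<in>T'. powers w #> t)"
  proof clarify
    fix h assume h: "h \<in> carrier G" "d h (g \<otimes> h) \<le> C"
    define b where "b = inv h \<otimes> (g \<otimes> h)"
    have b: "b \<in> U" using h gc d_move[of h \<one> "g \<otimes> h"] by (simp add: U_def b_def)
    have "\<exists>k. k \<in> carrier G \<and> inv k \<otimes> (g \<otimes> k) = b" using h(1) b_def by blast
    then have "rep b \<in> carrier G \<and> inv (rep b) \<otimes> (g \<otimes> rep b) = b" unfolding rep_def by (rule someI_ex)
    then obtain k where k: "k = rep b" "k \<in> carrier G" "inv k \<otimes> (g \<otimes> k) = b" by blast
    define c where "c = h \<otimes> inv k"
    have c: "c \<in> carrier G" using h k by (simp add: c_def)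
    have "k \<otimes> (inv k \<otimes> (g \<otimes> k)) = g \<otimes> k" "h \<otimes> (inv h \<otimes> (g \<otimes> h)) = g \<otimes> h"
      using h(1) k(2) gc by (simp_all flip: m_assoc)
    then have gk: "g \<otimes> k = k \<otimes> b" "g \<otimes> h = h \<otimes> b" unfolding k(3) b_def[symmetric] by simp_all
    have bc: "b \<in> carrier G" using b by (simp add: U_def)
    have "g \<otimes> c = h \<otimes> b \<otimes> inv k" using gk(2) gc h(1) k(2) by (simp add: c_def flip: m_assoc)
    also have "\<dots> = h \<otimes> inv k \<otimes> (k \<otimes> b) \<otimes> inv k" using h(1) k(2) bc by (simp add: m_assoc)
      (simp flip: m_assoc)
    also have "\<dots> = c \<otimes> g" unfolding gk(1)[symmetric] c_def using h(1) k(2) gc by (simp add: m_assoc)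
    finally have "c \<otimes> g [^] int 1 = g [^] int 1 \<otimes> c" using gc by simp
    then have "c \<otimes> g [^] int (1 * n) = g [^] int (1 * n) \<otimes> c" by (rule commute_int_pow(1)[OF gc c])
    then have "c \<otimes> w [^] int 1 = w [^] int 1 \<otimes> c" using w by (simp add: w_def)
    then have "c \<in> (\<Union>t\<in>T. powers w #> t)" using T(3) c by blast
    then obtain t z where t: "t \<in> T" "z \<in> powers w" "c = z \<otimes> t" unfolding r_coset_def by blast
    have tc: "t \<in> carrier G" "z \<in> carrier G" using t T w by auto
    have "h = c \<otimes> k" using h(1) k(2) by (simp add: c_def m_assoc)
    also have "\<dots> = z \<otimes> (t \<otimes> k)" using t(3) tc k(2) by (simp add: m_assoc)
    finally have "h \<in> powers w #> (t \<otimes> k)" using t(2) unfolding r_coset_def by blast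
    moreover have "t \<otimes> k \<in> T'" using t(1) k(1,2) b unfolding T'_def by force
    ultimately show "h \<in> (\<Union>t\<in>T'. powers w #> t)" by blast
  qed
  moreover have "infinite_order w" using lox loxodromic_imp_infinite_order unfolding w_def by blast
  ultimately show ?thesis by blast
qed

end

locale nonelementary_hyperbolic_metric_group = hyperbolic_metric_group +
  assumes torsion_free: "\<lbrakk>g \<in> carrier G; g \<noteq> \<one>\<rbrakk> \<Longrightarrow> infinite_order g"
    and not_virtually_cyclic: "infinite_order w \<Longrightarrow> infinite (rcosets (powers w))"
    and nontrivial: "\<exists>g\<in>carrier G. g \<noteq> \<one>"
begin

lemma exists_outside_commensurator:
  assumes lox: "loxodromic w \<kappa>"
  shows "\<exists>e\<in>carrier G. \<forall>k\<ge>1. e \<otimes> w [^] int k \<noteq> w [^] int k \<otimes> e"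
proof (rule ccontr)
  assume "\<not> ?thesis"
  then have "carrier G \<subseteq> {c \<in> carrier G. \<exists>k\<ge>1. c \<otimes> w [^] int k = w [^] int k \<otimes> c}" by blast
  moreover obtain T where T: "finite T" "T \<subseteq> carrier G"
    "{c \<in> carrier G. \<exists>k\<ge>1. c \<otimes> w [^] int k = w [^] int k \<otimes> c} \<subseteq> (\<Union>t\<in>T. powers w #> t)"
    using commensurator_finite_index[OF lox] .
  ultimately have "finite (rcosets (powers w))"
    using finite_rcosets_if_finite_covering[OF powers_subgroup[OF loxodromicD(1)[OF lox]]] by (meson subset_trans)
  then show False using not_virtually_cyclic[OF loxodromic_imp_infinite_order[OF lox]] by blast
qed

text \<open>
  Otherwise the group would be covered by finitely many cosets of infinite cyclic subgroups, one of
  which would have finite index.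
\<close>

lemma exists_displaced_by_all:
  assumes "finite M" "M \<subseteq> carrier G" "\<one> \<notin> M"
  shows "\<exists>h\<in>carrier G. \<forall>g\<in>M. C < d h (g \<otimes> h)"
proof (rule ccontr)
  assume neg: "\<not> ?thesis"
  define covers where "covers g w T \<longleftrightarrow> infinite_order w \<and> finite T \<and> T \<subseteq> carrier G \<and>
    {h \<in> carrier G. d h (g \<otimes> h) \<le> C} \<subseteq> (\<Union>t\<in>T. powers w #> t)" for g w T
  have "\<forall>g\<in>M. \<exists>w T. covers g w T"
  proof
    fix g assume "g \<in> M"
    then have "infinite_order g" using assms by (intro torsion_free) auto
    then show "\<exists>w T. covers g w T"
      unfolding covers_def by (rule boundedly_displaced_finite_cosets)
  qed
  from bchoice[OF this] obtain w where "\<forall>g\<in>M. \<exists>T. covers g (w g) T" ..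
  from bchoice[OF this] obtain T where "\<forall>g\<in>M. covers g (w g) (T g)" ..
  then have wT: "infinite_order (w g)" "finite (T g)" "T g \<subseteq> carrier G"
    "{h \<in> carrier G. d h (g \<otimes> h) \<le> C} \<subseteq> (\<Union>t\<in>T g. powers (w g) #> t)" if "g \<in> M" for g
    using that unfolding covers_def by blast+
  define S where "S = (\<lambda>g. powers (w g)) ` M"
  have "\<exists>H\<in>S. finite (rcosets H)"
  proof (rule coset_covering_finite_index[of _ "\<Union>g\<in>M. T g"])
    show "finite S" "finite (\<Union>g\<in>M. T g)" "(\<Union>g\<in>M. T g) \<subseteq> carrier G"
      using assms(1) wT(2,3) by (auto simp: S_def)
    show "subgroup H G" if "H \<in> S" for H
      using that wT(1) powers_subgroup infinite_order_carrier by (auto simp: S_def)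
    show "carrier G \<subseteq> (\<Union>H\<in>S. \<Union>t\<in>(\<Union>g\<in>M. T g). H #> t)"
    proof
      fix h assume h: "h \<in> carrier G"
      then obtain g where g: "g \<in> M" "d h (g \<otimes> h) \<le> C" using neg by (meson not_le)
      then have "h \<in> (\<Union>t\<in>T g. powers (w g) #> t)" using wT(4)[OF g(1)] h g(2) by blast
      then show "h \<in> (\<Union>H\<in>S. \<Union>t\<in>(\<Union>g\<in>M. T g). H #> t)" using g(1) unfolding S_def by blast
    qed
  qed
  then show False using wT(1) not_virtually_cyclic by (auto simp: S_def)
qed

text \<open>
  The direction of \<open>y\<close> and that of its inverse are not almost fixed by any element of \<open>M\<close>. The
  element \<open>y = p \<otimes> e \<otimes> inv p\<close> and its inverse both start with the long element
  \<open>p = h \<otimes> w [^] \<plusminus>n\<close>: little cancellation occurs around \<open>e\<close>, because the axis of \<open>w\<close> diverges from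
  its translate by \<open>e\<close>, and the sign is chosen such that little cancellation occurs after \<open>h\<close>. Hence \<open>h\<close>
  almost is an initial part of \<open>y\<close> and of its inverse, and each element of \<open>M\<close> moves \<open>h\<close> far away.
\<close>

lemma exists_generic_element:
  assumes M: "finite M" "M \<subseteq> carrier G" "\<one> \<notin> M"
  shows "\<exists>K. \<forall>R. \<exists>y\<in>carrier G. R \<le> d \<one> y \<and>
    (\<forall>g\<in>M. gp \<one> y (g \<otimes> y) \<le> K \<and> gp \<one> (inv y) (g \<otimes> inv y) \<le> K)"
proof -
  obtain g\<^sub>0 where "g\<^sub>0 \<in> carrier G" "g\<^sub>0 \<noteq> \<one>" using nontrivial by blast
  then obtain n\<^sub>0 :: nat and \<kappa> where "loxodromic (g\<^sub>0 [^] int n\<^sub>0) \<kappa>"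
    using infinite_order_imp_loxodromic_power torsion_free by metis
  then obtain w where lox: "loxodromic w \<kappa>" by blast
  note w = loxodromicD(1)[OF lox] and \<kappa> = loxodromicD(3)[OF lox]
  obtain e where e: "e \<in> carrier G" "\<And>k. k \<ge> 1 \<Longrightarrow> e \<otimes> w [^] int k \<noteq> w [^] int k \<otimes> e"
    using exists_outside_commensurator[OF lox] by blast
  obtain E where E: "\<forall>n::int. gp \<one> (w [^] n) (e \<otimes> w [^] n) \<le> E"
    using axis_diverges_from_translate[OF lox e] by blast
  define D where "D = (\<Sum>g\<in>M. d \<one> g)"
  have D: "d \<one> g \<le> D" if "g \<in> M" for g
    unfolding D_def using that M by (intro member_le_sum) (auto simp: d_nonneg)
  obtain h where h: "h \<in> carrier G"
    and moved: "\<And>g. g \<in> M \<Longrightarrow> 3 * D + 2 * (\<kappa> + \<delta>) + 4 * \<delta> < d h (g \<otimes> h)"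
    using exists_displaced_by_all[OF M] by blast
  have h0: "0 \<le> d \<one> h" using h by (simp add: d_nonneg)
  \<comment> \<open>\<open>h\<close>, \<open>e\<close> and \<open>w\<close> are fixed before the exponent \<open>n\<close>, so the bound \<open>d \<one> h + 2 * \<delta>\<close> on the
    Gromov products does not depend on the length of \<open>y\<close>\<close>
  have "\<exists>y\<in>carrier G. R \<le> d \<one> y \<and>
    (\<forall>g\<in>M. gp \<one> y (g \<otimes> y) \<le> d \<one> h + 2 * \<delta> \<and> gp \<one> (inv y) (g \<otimes> inv y) \<le> d \<one> h + 2 * \<delta>)" for R
  proof -
    define K1 where "K1 = E + 2 * d \<one> h"
    obtain n :: nat where n: "\<bar>R\<bar> + D + d \<one> e + 2 * \<bar>K1\<bar> + 2 * d \<one> h + 2 * \<delta> + 1 < real n"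
      using reals_Archimedean2 by blast
    have "min (gp \<one> (w [^] (- int n)) (inv h)) (gp \<one> (inv h) (w [^] int n)) \<le> \<kappa> + \<delta>"
    proof -
      have "gp \<one> (w [^] (- int n)) (w [^] int n) \<le> \<kappa>" using lox unfolding loxodromic_def by blast
      then show ?thesis
        using gp_four_point[of \<one> "w [^] (- int n)" "inv h" "w [^] int n"] w h by simp
    qed
    then have "gp \<one> (inv h) (w [^] (- int n)) \<le> \<kappa> + \<delta> \<or> gp \<one> (inv h) (w [^] int n) \<le> \<kappa> + \<delta>"
      by (simp add: gp_commute min_le_iff_disj)
    moreover have "\<bar>- int n\<bar> = int n" "\<bar>int n\<bar> = int n" by simp_all
    ultimately obtain i :: int where i: "\<bar>i\<bar> = int n" "gp \<one> (inv h) (w [^] i) \<le> \<kappa> + \<delta>"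
      by blast
    define W where "W = w [^] i"
    have W: "W \<in> carrier G" "real n \<le> d \<one> W"
      using w loxodromicD(2)[OF lox, of i] i(1) by (simp_all add: W_def)
    define p where "p = h \<otimes> W"
    have p: "p \<in> carrier G" "inv p = inv W \<otimes> inv h" using h W by (simp_all add: p_def inv_mult_group)
    have pn: "real n - d \<one> h \<le> d \<one> p"
      using d_triangle[of h \<one> p] p h W d_mult_right[of h W] d_commute[of h \<one>] by (simp add: p_def)
    \<comment> \<open>\<open>h\<close> is almost an initial part of \<open>p\<close>, and \<open>g\<close> moves \<open>h\<close> too far for \<open>p\<close> and \<open>g \<otimes> p\<close> to stay
      together beyond \<open>h\<close>\<close>
    have gpp: "gp \<one> p (g \<otimes> p) \<le> d \<one> h" if g: "g \<in> M" for g
    proof (rule ccontr)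
      assume far: "\<not> ?thesis"
      have gc: "g \<in> carrier G" using g M by blast
      have "gp h \<one> p = gp \<one> (inv h) W"
        using gp_base_mult[of h "inv h" W] h W by (simp add: p_def)
      then have "d \<one> h - (\<kappa> + \<delta>) \<le> gp \<one> h p" using i(2) gp_swap_base[of \<one> h p] by (simp add: W_def)
      then have "d h (g \<otimes> h) \<le> 3 * d \<one> g + 2 * (\<kappa> + \<delta>) + 4 * \<delta>"
        using far h p gc \<kappa> delta_nonneg by (intro displacement_of_prefix) auto
      then show False using moved[OF g] D[OF g] by simp
    qed
    have turn: "gp \<one> (inv p) (e \<otimes> inv p) \<le> K1"
    proof -
      have "inv W = w [^] (- i)" using w by (simp add: W_def int_pow_neg)
      then have "gp \<one> (inv W) (e \<otimes> inv W) \<le> E" using E by simp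
      moreover have "d (inv W) (inv p) = d \<one> h" "d (e \<otimes> inv W) (e \<otimes> inv p) = d \<one> h"
        using W h e by (simp_all add: p d_left_inv d_mult_right d_inv)
      ultimately show ?thesis
        using gp_le_gp_left[of \<one> "inv p" "inv W" "e \<otimes> inv p"]
          gp_le_gp_right[of \<one> "inv W" "e \<otimes> inv p" "e \<otimes> inv W"] W p(1) e(1)
          d_commute[of "inv p"] d_commute[of "e \<otimes> inv p"]
        by (simp add: K1_def)
    qed
    define y where "y = p \<otimes> (e \<otimes> inv p)"
    have y: "y \<in> carrier G" "inv y = p \<otimes> (inv e \<otimes> inv p)"
      using p(1) e(1) by (simp_all add: y_def inv_mult_group m_assoc)
    have tri: "d \<one> (e \<otimes> inv p) \<le> d \<one> e + d \<one> p" "d \<one> p - d \<one> e \<le> d \<one> (e \<otimes> inv p)"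
      "d \<one> (inv e \<otimes> inv p) \<le> d \<one> e + d \<one> p"
    proof -
      have *: "d \<one> (f \<otimes> inv p) \<le> d \<one> f + d \<one> p" "d \<one> p - d \<one> f \<le> d \<one> (f \<otimes> inv p)"
        if "f \<in> carrier G" for f
        using d_triangle[of \<one> f "f \<otimes> inv p"] d_triangle[of f \<one> "f \<otimes> inv p"] that p(1)
        by (simp_all add: d_mult_right d_inv d_commute[of f \<one>])
      show "d \<one> (e \<otimes> inv p) \<le> d \<one> e + d \<one> p" "d \<one> p - d \<one> e \<le> d \<one> (e \<otimes> inv p)"
        "d \<one> (inv e \<otimes> inv p) \<le> d \<one> e + d \<one> p"
        using *[of e] *(1)[of "inv e"] e(1) by (simp_all add: d_inv)
    qed
    have ylen: "2 * d \<one> p - d \<one> e - 2 * K1 \<le> d \<one> y"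
    proof -
      have "d \<one> y = d (inv p) (e \<otimes> inv p)"
        using d_move[of p "inv p" "e \<otimes> inv p"] d_left_inv[of p "inv p" "e \<otimes> inv p"] p(1) e(1)
        by (simp add: y_def)
      then show ?thesis using turn tri(2) p(1) unfolding gp_def by (simp add: d_inv)
    qed
    have start: "d \<one> p - d \<one> e - K1 \<le> gp \<one> p z" if "z = y \<or> z = inv y" for z
    proof -
      have "d \<one> z = d \<one> y" using that y(1) by (auto simp: d_inv)
      moreover have "d p z \<le> d \<one> e + d \<one> p"
        using that tri p(1) e(1) unfolding y(2) by (auto simp: y_def d_mult_right)
      ultimately show ?thesis using ylen unfolding gp_def by simp
    qed
    have "gp \<one> z (g \<otimes> z) \<le> d \<one> h + 2 * \<delta>" if z: "z = y \<or> z = inv y" and g: "g \<in> M" for z g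
    proof -
      have c: "g \<in> carrier G" "z \<in> carrier G" using z g y(1) M by auto
      have big: "D + d \<one> h + 2 * \<delta> + 1 \<le> gp \<one> p z" using start[OF z] pn n by linarith
      have "gp \<one> p z \<le> gp \<one> (g \<otimes> z) (g \<otimes> p) + d \<one> g"
        using gp_le_gp_base[of g \<one> "g \<otimes> z" "g \<otimes> p"] gp_base_mult[of g z p] c p(1)
        by (simp add: gp_commute d_commute)
      moreover have "min (gp \<one> p z) (gp \<one> z (g \<otimes> z)) \<le> gp \<one> p (g \<otimes> z) + \<delta>"
        "min (gp \<one> p (g \<otimes> z)) (gp \<one> (g \<otimes> z) (g \<otimes> p)) \<le> gp \<one> p (g \<otimes> p) + \<delta>"
        using c p(1) by (simp_all add: gp_four_point)
      ultimately show ?thesis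
        using gpp[OF g] D[OF g] big delta_nonneg d_nonneg[of \<one> g] c
        by (simp add: min_def split: if_splits)
    qed
    moreover have "R \<le> d \<one> y" using ylen pn n h0 d_nonneg[of \<one> e] e(1) D_def
        sum_nonneg[of M "d \<one>"] M d_nonneg delta_nonneg by (smt (verit) one_closed subsetD)
    ultimately show ?thesis using y(1) by blast
  qed
  then show ?thesis by blast
qed

end

section \<open>Products of conjugates\<close>

context hyperbolic_metric_group
begin

lemma foldr_mult_snoc:
  "set xs \<subseteq> carrier G \<Longrightarrow> a \<in> carrier G \<Longrightarrow> foldr (\<otimes>) xs \<one> \<in> carrier G \<and>
    foldr (\<otimes>) (xs @ [a]) \<one> = foldr (\<otimes>) xs \<one> \<otimes> a"
  by (induction xs) (auto simp: m_assoc)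

text \<open>
  Cutting the product inside the conjugates instead of between them gives the chain of points
  \<open>Q j \<otimes> inv (x (j + 1))\<close>, whose steps \<open>g j \<otimes> x j \<otimes> inv (x (j + 1))\<close> are long because the inverses
  of \<open>x j\<close> and \<open>x (j + 1)\<close> have different directions. At the corner between two steps, the
  incoming one is seen in the direction of \<open>u = x (j + 1)\<close> and the outgoing one in the direction of
  \<open>g (j + 1) \<otimes> u\<close>, so the turn is small.
\<close>

lemma conjugate_product_chain:
  fixes x g :: "nat \<Rightarrow> 'a" and X M :: "'a set" and K D R :: real
  defines "Q \<equiv> \<lambda>j. foldr (\<otimes>) (map (\<lambda>i. inv (x i) \<otimes> g i \<otimes> x i) [1..<Suc j]) \<one>"
  assumes X: "X \<subseteq> carrier G" and M: "M \<subseteq> carrier G"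
    and M_short: "\<And>g. g \<in> M \<Longrightarrow> d \<one> g \<le> D"
    and X_long: "\<And>u. u \<in> X \<Longrightarrow> R \<le> d \<one> u"
    and M_moves: "\<And>u g. u \<in> X \<Longrightarrow> g \<in> M \<Longrightarrow> gp \<one> u (g \<otimes> u) \<le> K"
    and X_inv: "\<And>u v. u \<in> X \<Longrightarrow> v \<in> X \<Longrightarrow> u \<noteq> v \<Longrightarrow> gp \<one> (inv u) (inv v) \<le> K"
    and R: "2 * K + 2 * D + 3 * \<delta> < R" and "0 \<le> K" "0 \<le> D"
    and x: "\<And>i. i \<in> {1..Suc N} \<Longrightarrow> x i \<in> X" and g: "\<And>i. i \<in> {1..N} \<Longrightarrow> g i \<in> M"
    and neq: "\<And>i. i \<in> {1..N} \<Longrightarrow> x i \<noteq> x (Suc i)" and N: "N \<ge> 1"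
  shows "2 * R - 2 * K - D \<le> d (inv (x 1)) (Q N \<otimes> inv (x (Suc N)))"
proof -
  have xc: "x i \<in> carrier G" if "i \<in> {1..Suc N}" for i using x[OF that] X by blast
  have gc: "g i \<in> carrier G" if "i \<in> {1..N}" for i using g[OF that] M by blast
  have Qs: "Q j \<in> carrier G \<and> (j < N \<longrightarrow> Q (Suc j) = Q j \<otimes> (inv (x (Suc j)) \<otimes> g (Suc j) \<otimes> x (Suc j)))"
    if "j \<le> N" for j
  proof -
    have s: "set (map (\<lambda>i. inv (x i) \<otimes> g i \<otimes> x i) [1..<Suc j]) \<subseteq> carrier G"
      using that xc gc by auto
    have "Q j \<in> carrier G" unfolding Q_def using foldr_mult_snoc[OF s one_closed] by blast
    moreover have "Q (Suc j) = Q j \<otimes> (inv (x (Suc j)) \<otimes> g (Suc j) \<otimes> x (Suc j))" if "j < N"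
    proof -
      have "[1..<Suc (Suc j)] = [1..<Suc j] @ [Suc j]" by simp
      then have e: "map (\<lambda>i. inv (x i) \<otimes> g i \<otimes> x i) [1..<Suc (Suc j)] =
          map (\<lambda>i. inv (x i) \<otimes> g i \<otimes> x i) [1..<Suc j] @ [inv (x (Suc j)) \<otimes> g (Suc j) \<otimes> x (Suc j)]"
        by (simp only: map_append list.map)
      have "inv (x (Suc j)) \<otimes> g (Suc j) \<otimes> x (Suc j) \<in> carrier G" using xc gc that by simp
      then show ?thesis unfolding Q_def e using foldr_mult_snoc[OF s] by blast
    qed
    ultimately show ?thesis by blast
  qed
  define v where "v j = Q j \<otimes> inv (x (Suc j))" for j
  have vc: "v j \<in> carrier G" if "j \<le> N" for j using that Qs xc by (simp add: v_def)
  define s where "s j = g (Suc j) \<otimes> (x (Suc j) \<otimes> inv (x (Suc (Suc j))))" for j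
  have sc: "s j \<in> carrier G" if "j < N" for j using that xc gc by (simp add: s_def)
  have vs: "v (Suc j) = v j \<otimes> s j" if "j < N" for j
  proof -
    have c: "Q j \<in> carrier G" "x (Suc j) \<in> carrier G" "x (Suc (Suc j)) \<in> carrier G" "g (Suc j) \<in> carrier G"
      using that Qs xc gc by auto
    have "Q (Suc j) = Q j \<otimes> (inv (x (Suc j)) \<otimes> g (Suc j) \<otimes> x (Suc j))" using Qs that by simp
    then show ?thesis using c by (simp add: v_def s_def m_assoc)
  qed
  \<comment> \<open>little of \<open>u\<close> cancels in \<open>u \<otimes> inv a\<close> and \<open>u \<otimes> inv b\<close>, so the corner is that of \<open>u\<close> and \<open>f \<otimes> u\<close>\<close>
  have turn_at: "gp \<one> (u \<otimes> inv a) (f \<otimes> (u \<otimes> inv b)) \<le> K + 2 * \<delta>"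
    if "u \<in> X" "a \<in> X" "b \<in> X" "u \<noteq> a" "u \<noteq> b" "f \<in> M" for u a b f
  proof -
    have c: "u \<in> carrier G" "a \<in> carrier G" "b \<in> carrier G" "f \<in> carrier G" using that X M by auto
    have *: "R - K \<le> gp \<one> u (u \<otimes> inv a)" if "a \<in> X" "u \<noteq> a" for a
    proof -
      have ac: "a \<in> carrier G" using that X by blast
      have "gp u \<one> (u \<otimes> inv a) = gp \<one> (inv u) (inv a)"
        using gp_base_mult[of u "inv u" "inv a"] c ac by simp
      then show ?thesis
        using gp_swap_base[of \<one> u "u \<otimes> inv a"] X_inv[of u a] X_long[of u] \<open>u \<in> X\<close> that by simp
    qed
    have "gp \<one> u (u \<otimes> inv b) \<le> gp \<one> (f \<otimes> (u \<otimes> inv b)) (f \<otimes> u) + d \<one> f"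
      using gp_le_gp_base[of f \<one> "f \<otimes> (u \<otimes> inv b)" "f \<otimes> u"] gp_base_mult[of f "u \<otimes> inv b" u] c
      by (simp add: gp_commute d_commute)
    then have "R - K - D \<le> gp \<one> (f \<otimes> (u \<otimes> inv b)) (f \<otimes> u)"
      using *[of b] M_short[of f] that by simp
    moreover have "R - K \<le> gp \<one> u (u \<otimes> inv a)" "gp \<one> u (f \<otimes> u) \<le> K" using *[of a] M_moves that by auto
    moreover have "min (gp \<one> u (u \<otimes> inv a)) (gp \<one> (u \<otimes> inv a) (f \<otimes> (u \<otimes> inv b)))
        \<le> gp \<one> u (f \<otimes> (u \<otimes> inv b)) + \<delta>"
      "min (gp \<one> u (f \<otimes> (u \<otimes> inv b))) (gp \<one> (f \<otimes> (u \<otimes> inv b)) (f \<otimes> u)) \<le> gp \<one> u (f \<otimes> u) + \<delta>"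
      using c by (simp_all add: gp_four_point)
    ultimately show ?thesis
      using R \<open>0 \<le> K\<close> \<open>0 \<le> D\<close> delta_nonneg by (simp add: min_def split: if_splits)
  qed
  have long: "2 * R - 2 * K - D \<le> d (v j) (v (Suc j))" if j: "j < N" for j
  proof -
    define u where "u = x (Suc j)"
    define a where "a = x (Suc (Suc j))"
    have ua: "u \<in> X" "a \<in> X" "u \<noteq> a" using x neq j by (auto simp: u_def a_def)
    have c: "u \<in> carrier G" "a \<in> carrier G" "g (Suc j) \<in> carrier G" using ua X gc j by auto
    have "d \<one> (u \<otimes> inv a) = d (inv u) (inv a)"
      using d_left_inv[of u "inv u" "inv a"] c by simp
    then have "2 * R - 2 * K \<le> d \<one> (u \<otimes> inv a)"
      using X_inv[of u a] X_long[of u] X_long[of a] ua c unfolding gp_def by (simp add: d_inv)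
    moreover have "d \<one> (u \<otimes> inv a) = d (g (Suc j)) (s j)"
      using c by (simp add: s_def d_mult_right u_def a_def)
    moreover have "d (g (Suc j)) (s j) \<le> d (g (Suc j)) \<one> + d \<one> (s j)"
      using c sc[OF j] by (intro d_triangle) simp_all
    moreover have "d (v j) (v (Suc j)) = d \<one> (s j)" using vs[OF j] vc sc j by (simp add: d_mult_right)
    moreover have "d (g (Suc j)) \<one> \<le> D" using M_short[of "g (Suc j)"] g j d_commute by simp
    ultimately show ?thesis by simp
  qed
  have turn: "gp (v (Suc j)) (v j) (v (Suc (Suc j))) \<le> K + 2 * \<delta> + D" if j: "j + 2 \<le> N" for j
  proof -
    define u where "u = x (Suc (Suc j))"
    define a where "a = x (Suc j)"
    define b where "b = x (Suc (Suc (Suc j)))"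
    define f where "f = g (Suc (Suc j))"
    define f' where "f' = g (Suc j)"
    have ua: "u \<in> X" "a \<in> X" "b \<in> X" "u \<noteq> a" "u \<noteq> b" "f \<in> M" "f' \<in> M"
      using x g neq[of "Suc j"] neq[of "Suc (Suc j)"] j by (auto simp: u_def a_def b_def f_def f'_def)
    then have c: "u \<in> carrier G" "a \<in> carrier G" "b \<in> carrier G" "f \<in> carrier G" "f' \<in> carrier G"
      using X M by auto
    have s: "s j = f' \<otimes> (a \<otimes> inv u)" "s (Suc j) = f \<otimes> (u \<otimes> inv b)"
      by (simp_all add: s_def u_def a_def b_def f_def f'_def)
    have vj: "v j = v (Suc j) \<otimes> inv (s j)"
      using vs[of j] vc[of j] sc[of j] j by (simp add: m_assoc)
    have "gp (v (Suc j)) (v j) (v (Suc (Suc j))) = gp \<one> (inv (s j)) (s (Suc j))"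
      using vs[of "Suc j"] vj gp_base_mult[of "v (Suc j)" "inv (s j)" "s (Suc j)"] vc[of "Suc j"]
        sc[of j] sc[of "Suc j"] j by simp
    also have "inv (s j) = (u \<otimes> inv a) \<otimes> inv f'" using c by (simp add: s inv_mult_group m_assoc)
    also have "gp \<one> ((u \<otimes> inv a) \<otimes> inv f') (s (Suc j)) \<le>
        gp \<one> (u \<otimes> inv a) (s (Suc j)) + d ((u \<otimes> inv a) \<otimes> inv f') (u \<otimes> inv a)"
      using c sc[of "Suc j"] j by (intro gp_le_gp_left) simp_all
    also have "d ((u \<otimes> inv a) \<otimes> inv f') (u \<otimes> inv a) = d \<one> f'"
      using c d_mult_right[of "u \<otimes> inv a" "inv f'"] by (simp add: d_commute[of _ "u \<otimes> inv a"] d_inv)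
    also have "gp \<one> (u \<otimes> inv a) (s (Suc j)) + d \<one> f' \<le> K + 2 * \<delta> + D"
      using turn_at[of u a b f] M_short[of f'] ua by (simp add: s)
    finally show ?thesis by simp
  qed
  have gap: "2 * (K + 2 * \<delta> + D) + 2 * \<delta> < 2 * R - 2 * K - D"
    using R \<open>0 \<le> K\<close> \<open>0 \<le> D\<close> delta_nonneg by simp
  obtain N' where N': "N = Suc N'" using N by (cases N) auto
  have "2 * R - 2 * K - D + real N' * (2 * R - 2 * K - D - 2 * (K + 2 * \<delta> + D) - 2 * \<delta>)
      \<le> d (v 0) (v (Suc N'))"
    using chain_progress(2)[of N v "2 * R - 2 * K - D" "K + 2 * \<delta> + D" N', OF vc long turn gap] N'
    by simp
  moreover have "0 \<le> real N' * (2 * R - 2 * K - D - 2 * (K + 2 * \<delta> + D) - 2 * \<delta>)"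
    using gap by simp
  moreover have "v 0 = inv (x 1)" using xc[of 1] by (simp add: v_def Q_def)
  ultimately show ?thesis using N' by (simp add: v_def)
qed

end

context nonelementary_hyperbolic_metric_group
begin

text \<open>
  Let \<open>t \<noteq> \<one>\<close> and let \<open>y\<close> be long and generic for \<open>M\<close> together with the powers of \<open>t\<close> with small
  nonzero exponents. Then \<open>y\<close>, \<open>y \<otimes> t\<close> and \<open>y \<otimes> t \<otimes> t\<close> have the same direction as \<open>y\<close>, which no
  element of \<open>M\<close> fixes, and the directions of their inverses are different translates of the
  direction of \<open>inv y\<close> by powers of \<open>t\<close>. If the product of conjugates were \<open>\<one>\<close>, the chain of its
  partial products would return to a point near its start.
\<close>

theorem satisfies_property_star: "property_star G"
  unfolding property_star_def
proof (intro allI impI)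
  fix M :: "'a set" and m :: nat
  assume "finite M \<and> M \<subseteq> carrier G \<and> \<one> \<notin> M \<and> m \<ge> 2"
  then have M: "finite M" "M \<subseteq> carrier G" "\<one> \<notin> M" and m: "m \<ge> 2" by auto
  obtain t where t: "t \<in> carrier G" "t \<noteq> \<one>" using nontrivial by blast
  have t_inf: "infinite_order t" using torsion_free t by blast
  define S where "S = M \<union> (\<lambda>j::int. t [^] j) ` ({-2..2} - {0})"
  have S: "finite S" "S \<subseteq> carrier G" "\<one> \<notin> S"
    using M t infinite_order_int_pow_eq_one[OF t_inf] by (auto simp: S_def)
  obtain K where K: "\<forall>R. \<exists>y\<in>carrier G. R \<le> d \<one> y \<and>
    (\<forall>g\<in>S. gp \<one> y (g \<otimes> y) \<le> K \<and> gp \<one> (inv y) (g \<otimes> inv y) \<le> K)"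
    using exists_generic_element[OF S] ..
  define D where "D = (\<Sum>g\<in>M. d \<one> g)"
  have D: "d \<one> g \<le> D" if "g \<in> M" for g
    unfolding D_def using that M by (intro member_le_sum) (auto simp: d_nonneg)
  have D0: "0 \<le> D" unfolding D_def using M by (intro sum_nonneg) (auto simp: d_nonneg)
  define \<tau> where "\<tau> = 2 * d \<one> t"
  have \<tau>: "d \<one> (t [^] int j) \<le> \<tau>" if "j \<le> 2" for j
  proof -
    have "d \<one> (t [^] int j) \<le> real j * d \<one> t" using d_pow_mult_le[OF t(1), of j 1] t by simp
    also have "\<dots> \<le> 2 * d \<one> t" using that t by (intro mult_right_mono) (auto simp: d_nonneg)
    finally show ?thesis by (simp add: \<tau>_def)
  qed
  have \<tau>0: "0 \<le> \<tau>" using \<tau>[of 0] by (simp add: d_self)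
  define K' where "K' = \<bar>K\<bar> + 2 * \<tau>"
  define R where "R = 2 * K' + 2 * D + 3 * \<delta> + 1"
  obtain y where y: "y \<in> carrier G" "R + \<tau> \<le> d \<one> y"
    and gen: "\<And>g. g \<in> S \<Longrightarrow> gp \<one> y (g \<otimes> y) \<le> K" "\<And>g. g \<in> S \<Longrightarrow> gp \<one> (inv y) (g \<otimes> inv y) \<le> K"
    using K by blast
  define z where "z j = y \<otimes> t [^] int j" for j
  have zc: "z j \<in> carrier G" for j using y t by (simp add: z_def)
  have yz: "d y (z j) \<le> \<tau>" if "j \<le> 2" for j using \<tau>[OF that] y t by (simp add: z_def d_mult_right)
  define X where "X = z ` {..2}"
  have Xe: "X = {z 0, z 1, z 2}" by (auto simp: X_def atMost_Suc eval_nat_numeral)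
  have z_inj: "i = j" if "z i = z j" for i j
    using that y t infinite_order_pow_inj[OF t_inf, of "int i" "int j"] by (simp add: z_def)
  have X_long: "R \<le> d \<one> u" if "u \<in> X" for u
  proof -
    obtain j where j: "j \<le> 2" "u = z j" using \<open>u \<in> X\<close> by (auto simp: X_def)
    show ?thesis using yz[OF j(1)] y d_triangle[of \<one> "z j" y] zc[of j] d_commute[of y] j by simp
  qed
  have M_moves: "gp \<one> u (g \<otimes> u) \<le> K'" if "u \<in> X" "g \<in> M" for u g
  proof -
    obtain j where j: "j \<le> 2" "u = z j" using \<open>u \<in> X\<close> by (auto simp: X_def)
    have g: "g \<in> carrier G" "g \<in> S" using \<open>g \<in> M\<close> M by (auto simp: S_def)
    have "gp \<one> u (g \<otimes> u) \<le> gp \<one> y (g \<otimes> u) + d u y"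
      using j zc y g by (intro gp_le_gp_left) auto
    also have "gp \<one> y (g \<otimes> u) \<le> gp \<one> y (g \<otimes> y) + d (g \<otimes> u) (g \<otimes> y)"
      using j zc y g by (intro gp_le_gp_right) auto
    also have "d (g \<otimes> u) (g \<otimes> y) = d u y" using j zc y g by (simp add: d_left_inv)
    finally show ?thesis using gen(1)[OF g(2)] yz[OF j(1)] d_commute[of u y] j by (simp add: K'_def)
  qed
  have X_inv: "gp \<one> (inv u) (inv v) \<le> K'" if uv: "u \<in> X" "v \<in> X" "u \<noteq> v" for u v
  proof -
    obtain i j where ij: "i \<le> 2" "u = z i" "j \<le> 2" "v = z j" using uv by (auto simp: X_def)
    define b where "b = t [^] (int i - int j)"
    have "i \<noteq> j" using uv ij by auto
    then have bS: "b \<in> S" unfolding b_def S_def using ij by auto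
    have c: "b \<in> carrier G" "t [^] int i \<in> carrier G" using t by (simp_all add: b_def)
    have "t [^] int i \<otimes> inv (z i) = inv y" "t [^] int i \<otimes> inv (z j) = b \<otimes> inv y"
    proof -
      have *: "inv (z k) = t [^] (- int k) \<otimes> inv y" for k
        using y t by (simp add: z_def inv_mult_group int_pow_neg)
      show "t [^] int i \<otimes> inv (z i) = inv y" "t [^] int i \<otimes> inv (z j) = b \<otimes> inv y"
        unfolding * b_def using y t by (simp_all flip: m_assoc int_pow_mult)
    qed
    then have "gp \<one> (inv u) (inv v) = gp (t [^] int i) (inv y) (b \<otimes> inv y)"
      using gp_base_mult[of "t [^] int i" "inv u" "inv v"] c zc ij by simp
    also have "\<dots> \<le> gp \<one> (inv y) (b \<otimes> inv y) + d (t [^] int i) \<one>"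
      using c y by (intro gp_le_gp_base) auto
    finally show ?thesis
      using gen(2)[OF bS] \<tau>[OF ij(1)] \<tau>0 d_commute[of "t [^] int i"] by (simp add: K'_def)
  qed
  have K'0: "0 \<le> K'" using \<tau>0 by (simp add: K'_def)
  have long: "D < 2 * R - 2 * K' - D" using D0 K'0 delta_nonneg by (simp add: R_def)
  have chain: "2 * R - 2 * K' - D \<le> d (inv (x 1))
      (foldr (\<otimes>) (map (\<lambda>i. inv (x i) \<otimes> g i \<otimes> x i) [1..<Suc N]) \<one> \<otimes> inv (x (Suc N)))"
    if "\<And>i. i \<in> {1..Suc N} \<Longrightarrow> x i \<in> X" "\<And>i. i \<in> {1..N} \<Longrightarrow> g i \<in> M"
      "\<And>i. i \<in> {1..N} \<Longrightarrow> x i \<noteq> x (Suc i)" "N \<ge> 1" for x g :: "nat \<Rightarrow> 'a" and N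
  proof (rule conjugate_product_chain[where X = X and M = M])
    show "X \<subseteq> carrier G" using zc by (auto simp: X_def)
    show "2 * K' + 2 * D + 3 * \<delta> < R" by (simp add: R_def)
  qed (fact M(2) D X_long M_moves X_inv K'0 D0 that)+
  have main: "\<exists>i\<in>{1..m - 1}. x i = x (i + 1)"
    if gx: "\<forall>i\<in>{1..m}. g i \<in> M \<and> x i \<in> X"
      and prod: "foldr (\<otimes>) (map (\<lambda>i. inv (x i) \<otimes> g i \<otimes> x i) [1..<Suc m]) \<one> = \<one>"
    for g x :: "nat \<Rightarrow> 'a"
  proof (rule ccontr)
    assume "\<not> ?thesis"
    then have neq: "x i \<noteq> x (Suc i)" if "i \<in> {1..m - 1}" for i using that by simp
    have xc: "x i \<in> carrier G" "g i \<in> carrier G" if "i \<in> {1..m}" for i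
    proof -
      have "X \<subseteq> carrier G" using zc by (auto simp: X_def)
      then show "x i \<in> carrier G" "g i \<in> carrier G" using gx that M(2) by blast+
    qed
    show False
    proof (cases "x m = x 1")
      case False
      \<comment> \<open>the closed chain, with \<open>x 1\<close> repeated at the end\<close>
      define x' where "x' = x(Suc m := x 1)"
      have e: "map (\<lambda>i. inv (x' i) \<otimes> g i \<otimes> x' i) [1..<Suc m] = map (\<lambda>i. inv (x i) \<otimes> g i \<otimes> x i) [1..<Suc m]"
        by (rule map_cong) (auto simp: x'_def)
      have "2 * R - 2 * K' - D \<le> d (inv (x' 1))
          (foldr (\<otimes>) (map (\<lambda>i. inv (x' i) \<otimes> g i \<otimes> x' i) [1..<Suc m]) \<one> \<otimes> inv (x' (Suc m)))"
      proof (rule chain)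
        show "x' i \<in> X" if "i \<in> {1..Suc m}" for i
          using gx m that by (cases "i = Suc m") (auto simp: x'_def)
        show "x' i \<noteq> x' (Suc i)" if "i \<in> {1..m}" for i
        proof (cases "i = m")
          case False
          then have "i \<in> {1..m - 1}" using that by auto
          then show ?thesis using neq[of i] by (auto simp: x'_def)
        qed (use \<open>x m \<noteq> x 1\<close> m in \<open>auto simp: x'_def\<close>)
      qed (use gx m in auto)
      then have "2 * R - 2 * K' - D \<le> d (inv (x 1)) (inv (x 1))"
        unfolding e prod using xc[of 1] m by (simp add: x'_def)
      then show False using long D0 d_self[of "inv (x 1)"] xc[of 1] m by simp
    next
      case True
      define N where "N = m - 1"
      have N: "N \<ge> 1" "m = Suc N" using m by (auto simp: N_def)
      define Q where "Q = foldr (\<otimes>) (map (\<lambda>i. inv (x i) \<otimes> g i \<otimes> x i) [1..<Suc N]) \<one>"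
      have le: "2 * R - 2 * K' - D \<le> d (inv (x 1)) (Q \<otimes> inv (x m))"
        unfolding Q_def N(2) by (rule chain) (use gx neq N in auto)
      have s: "set (map (\<lambda>i. inv (x i) \<otimes> g i \<otimes> x i) [1..<Suc N]) \<subseteq> carrier G"
        using xc N by auto
      have mc: "x m \<in> carrier G" "g m \<in> carrier G" using xc m by auto
      have "[1..<Suc m] = [1..<Suc N] @ [m]" using N by simp
      then have "map (\<lambda>i. inv (x i) \<otimes> g i \<otimes> x i) [1..<Suc m] =
          map (\<lambda>i. inv (x i) \<otimes> g i \<otimes> x i) [1..<Suc N] @ [inv (x m) \<otimes> g m \<otimes> x m]"
        by (simp only: map_append list.map)
      then have Q: "Q \<in> carrier G" "Q \<otimes> (inv (x m) \<otimes> g m \<otimes> x m) = \<one>"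
        using foldr_mult_snoc[OF s, of "inv (x m) \<otimes> g m \<otimes> x m"] mc prod unfolding Q_def by auto
      define v where "v = Q \<otimes> inv (x m)"
      have v: "v \<in> carrier G" using Q mc by (simp add: v_def)
      have "v \<otimes> g m \<otimes> x m = \<one>" using Q mc by (simp add: v_def m_assoc)
      then have "v \<otimes> g m = inv (x m)" using v mc by (metis inv_equality inv_inv m_closed)
      then have "d (inv (x 1)) v = d \<one> (g m)"
        using d_mult_right[OF v mc(2)] d_commute True by simp
      also have "\<dots> \<le> D" using D gx m by simp
      finally show False using le long by (simp add: v_def)
    qed
  qed
  show "\<exists>a\<in>carrier G. \<exists>b\<in>carrier G. \<exists>c\<in>carrier G. a \<noteq> b \<and> b \<noteq> c \<and> a \<noteq> c \<and>
    (\<forall>g x. (\<forall>i\<in>{1..m}. g i \<in> M \<and> x i \<in> {a, b, c}) \<and>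
      foldr (\<otimes>) (map (\<lambda>i. inv (x i) \<otimes> g i \<otimes> x i) [1..<Suc m]) \<one> = \<one>
      \<longrightarrow> (\<exists>i\<in>{1..m - 1}. x i = x (i + 1)))"
  proof (rule bexI[of _ "z 0"], rule bexI[of _ "z 1"], rule bexI[of _ "z 2"], intro conjI allI impI)
    show "z 0 \<noteq> z 1" "z 1 \<noteq> z 2" "z 0 \<noteq> z 2" using z_inj by fastforce+
    fix g x :: "nat \<Rightarrow> 'a"
    assume "(\<forall>i\<in>{1..m}. g i \<in> M \<and> x i \<in> {z 0, z 1, z 2}) \<and>
      foldr (\<otimes>) (map (\<lambda>i. inv (x i) \<otimes> g i \<otimes> x i) [1..<Suc m]) \<one> = \<one>"
    then show "\<exists>i\<in>{1..m - 1}. x i = x (i + 1)" using main[of g x] Xe by blast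
  qed (use zc in auto)
qed

end

section \<open>The word metric of a hyperbolic group\<close>

context group
begin

lemma cayley_edges_in_carrier:
  assumes "X \<subseteq> carrier G" "(g, h) \<in> cayley_edges G X \<union> (cayley_edges G X)\<inverse>"
  shows "g \<in> carrier G \<and> h \<in> carrier G"
  using assms by (auto simp: cayley_edges_def)

lemma cayley_path_in_carrier:
  assumes "X \<subseteq> carrier G" "(g, h) \<in> (cayley_edges G X \<union> (cayley_edges G X)\<inverse>) ^^ n" "g \<in> carrier G"
  shows "h \<in> carrier G"
  using assms(2)
proof (induction n arbitrary: h)
  case 0
  then show ?case using assms by simp
next
  case (Suc n)
  then show ?case using cayley_edges_in_carrier[OF assms(1)] by auto
qed

lemma cayley_path_translate:
  assumes "X \<subseteq> carrier G" "k \<in> carrier G"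
    "(g, h) \<in> (cayley_edges G X \<union> (cayley_edges G X)\<inverse>) ^^ n"
  shows "(k \<otimes> g, k \<otimes> h) \<in> (cayley_edges G X \<union> (cayley_edges G X)\<inverse>) ^^ n"
  using assms(3)
proof (induction n arbitrary: h)
  case (Suc n)
  have edge: "(k \<otimes> a, k \<otimes> b) \<in> cayley_edges G X" if ab: "(a, b) \<in> cayley_edges G X" for a b
  proof -
    obtain x where x: "a \<in> carrier G" "x \<in> X" "b = a \<otimes> x" using ab by (auto simp: cayley_edges_def)
    then have "k \<otimes> b = k \<otimes> a \<otimes> x" using assms by (auto simp: m_assoc)
    then show ?thesis using x assms unfolding cayley_edges_def by auto
  qed
  obtain b where b: "(g, b) \<in> (cayley_edges G X \<union> (cayley_edges G X)\<inverse>) ^^ n"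
    "(b, h) \<in> cayley_edges G X \<union> (cayley_edges G X)\<inverse>" using Suc.prems by auto
  have "(k \<otimes> b, k \<otimes> h) \<in> cayley_edges G X \<union> (cayley_edges G X)\<inverse>" using b(2) edge by auto
  then show ?case using Suc.IH[OF b(1)] by auto
qed simp

lemma finite_cayley_sphere:
  assumes "X \<subseteq> carrier G" "finite X"
  shows "finite {h. (\<one>, h) \<in> (cayley_edges G X \<union> (cayley_edges G X)\<inverse>) ^^ n}"
proof (induction n)
  case (Suc n)
  let ?S = "{h. (\<one>, h) \<in> (cayley_edges G X \<union> (cayley_edges G X)\<inverse>) ^^ n}"
  have "{h. (\<one>, h) \<in> (cayley_edges G X \<union> (cayley_edges G X)\<inverse>) ^^ Suc n} \<subseteq>
      (\<lambda>(g, x). g \<otimes> x) ` (?S \<times> (X \<union> (\<lambda>x. inv x) ` X))"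
  proof clarify
    fix h assume "(\<one>, h) \<in> (cayley_edges G X \<union> (cayley_edges G X)\<inverse>) ^^ Suc n"
    then obtain g where g: "g \<in> ?S" "(g, h) \<in> cayley_edges G X \<or> (h, g) \<in> cayley_edges G X" by auto
    then consider x where "x \<in> X" "h = g \<otimes> x" | x where "x \<in> X" "h \<in> carrier G" "g = h \<otimes> x"
      unfolding cayley_edges_def by auto
    then obtain x where "x \<in> X \<union> (\<lambda>x. inv x) ` X" "h = g \<otimes> x"
    proof cases
      case (2 x)
      then have "h = g \<otimes> inv x" using assms(1) by (auto simp: m_assoc)
      then show thesis using that 2 by blast
    qed (use that in blast)
    then show "h \<in> (\<lambda>(g, x). g \<otimes> x) ` (?S \<times> (X \<union> (\<lambda>x. inv x) ` X))" using g(1) by force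
  qed
  then show ?case using Suc assms(2) by (meson finite_SigmaI finite_UnI finite_imageI finite_subset)
qed simp

lemma word_metric_hyperbolic:
  assumes X: "finite X" "X \<subseteq> carrier G" "generate G X = carrier G" and "\<delta> > 0"
    and thin: "Metric_space.thin_triangles (cayley_space G X) (cayley_dist G X) \<delta>"
  shows "hyperbolic_metric_group G (\<lambda>g h. real (cayley_vdist G X g h)) (3 * \<delta>)"
proof -
  let ?R = "cayley_edges G X \<union> (cayley_edges G X)\<inverse>"
  interpret C: Metric_space "cayley_space G X" "cayley_dist G X"
    by (rule cayley_metric[OF X(3)])
  have vd: "cayley_dist G X (Vertex g) (Vertex h) = real (cayley_vdist G X g h)" for g h
    by (simp add: cayley_dist_def)
  have vc: "Vertex g \<in> cayley_space G X" if "g \<in> carrier G" for g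
    using that by (simp add: cayley_space_def)
  have tr_le: "cayley_vdist G X (k \<otimes> g) (k \<otimes> h) \<le> cayley_vdist G X g h"
    if "k \<in> carrier G" "g \<in> carrier G" "h \<in> carrier G" for k g h
    using that by (intro cayley_vdist_le[OF X(3)] cayley_path_translate cayley_vdist_relpow[OF X(3)] X(2))
  show ?thesis
  proof unfold_locales
    show "real (cayley_vdist G X x x) = 0" for x by simp
    show "real (cayley_vdist G X x y) = real (cayley_vdist G X y x)" for x y
      by (simp add: cayley_vdist_commute)
    show "real (cayley_vdist G X x z) \<le> real (cayley_vdist G X x y) + real (cayley_vdist G X y z)"
      if "x \<in> carrier G" "y \<in> carrier G" "z \<in> carrier G" for x y z
      using cayley_vdist_triangle[OF X(3) that] by simp
    show "real (cayley_vdist G X (g \<otimes> x) (g \<otimes> y)) = real (cayley_vdist G X x y)"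
      if c: "g \<in> carrier G" "x \<in> carrier G" "y \<in> carrier G" for g x y
    proof -
      have "inv g \<otimes> (g \<otimes> x) = x" "inv g \<otimes> (g \<otimes> y) = y" using c by (simp_all flip: m_assoc)
      then show ?thesis using tr_le[of g x y] tr_le[of "inv g" "g \<otimes> x" "g \<otimes> y"] c by simp
    qed
    show "finite {x \<in> carrier G. real (cayley_vdist G X \<one> x) \<le> r}" for r
    proof (rule finite_subset)
      show "{x \<in> carrier G. real (cayley_vdist G X \<one> x) \<le> r} \<subseteq> (\<Union>n\<le>nat \<lfloor>r\<rfloor>. {h. (\<one>, h) \<in> ?R ^^ n})"
      proof clarify
        fix x assume x: "x \<in> carrier G" "real (cayley_vdist G X \<one> x) \<le> r"
        then have "cayley_vdist G X \<one> x \<le> nat \<lfloor>r\<rfloor>" by linarith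
        moreover have "(\<one>, x) \<in> ?R ^^ cayley_vdist G X \<one> x"
          using cayley_vdist_relpow[OF X(3) one_closed x(1)] .
        ultimately show "x \<in> (\<Union>n\<le>nat \<lfloor>r\<rfloor>. {h. (\<one>, h) \<in> ?R ^^ n})" by blast
      qed
      show "finite (\<Union>n\<le>nat \<lfloor>r\<rfloor>. {h. (\<one>, h) \<in> ?R ^^ n})"
        using finite_cayley_sphere[OF X(2,1)] by blast
    qed
    show "\<exists>p\<in>carrier G. real (cayley_vdist G X x p) = real k \<and>
        real (cayley_vdist G X p y) = real (cayley_vdist G X x y) - real k"
      if c: "x \<in> carrier G" "y \<in> carrier G" and k: "real k \<le> real (cayley_vdist G X x y)" for x y k
    proof -
      define l where "l = cayley_vdist G X x y - k"
      have kl: "cayley_vdist G X x y = k + l" using k by (simp add: l_def)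
      then have "(x, y) \<in> ?R ^^ (k + l)" using cayley_vdist_relpow[OF X(3) c] by simp
      then obtain p where p: "(x, p) \<in> ?R ^^ k" "(p, y) \<in> ?R ^^ l" by (auto simp: relpow_add)
      have pc: "p \<in> carrier G" using cayley_path_in_carrier[OF X(2) p(1) c(1)] .
      have "cayley_vdist G X x p \<le> k" "cayley_vdist G X p y \<le> l"
        using p cayley_vdist_le[OF X(3)] by blast+
      moreover have "k + l \<le> cayley_vdist G X x p + cayley_vdist G X p y"
        using cayley_vdist_triangle[OF X(3) c(1) pc c(2)] kl by simp
      ultimately show ?thesis using pc kl by (intro bexI[of _ p]) auto
    qed
    show "real (cayley_vdist G X x z) + real (cayley_vdist G X y w) \<le>
        max (real (cayley_vdist G X x y) + real (cayley_vdist G X z w))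
          (real (cayley_vdist G X x w) + real (cayley_vdist G X y z)) + 2 * (3 * \<delta>)"
      if "x \<in> carrier G" "y \<in> carrier G" "z \<in> carrier G" "w \<in> carrier G" for x y z w
      using C.thin_triangles_imp_four_point[OF thin \<open>\<delta> > 0\<close> cayley_geodesic[OF X(3)]
          vc[OF that(1)] vc[OF that(2)] vc[OF that(3)] vc[OF that(4)]]
      by (simp add: vd)
  qed
qed

lemma finite_index_powers_imp_virtually_infinite_cyclic:
  assumes w: "w \<in> carrier G" and inf: "infinite (range (\<lambda>j::int. w [^] j))"
    and fin: "finite (rcosets (range (\<lambda>j::int. w [^] j)))"
  shows "virtually_infinite_cyclic G"
proof -
  let ?H = "range (\<lambda>j::int. w [^] j)"
  have H: "?H = generate G {w}" using generate_pow[OF w] by (simp add: full_SetCompr_eq)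
  have sub: "subgroup ?H G" using w by (simp add: H generate_is_subgroup)
  have "generate G (carrier G \<inter> ?H) = ?H"
    using subgroup.carrier_subgroup_generated_subgroup[OF sub]
    by (simp only: carrier_subgroup_generated)
  then have "subgroup_generated G ?H = subgroup_generated G {w}"
    using w by (simp add: subgroup_generated_def H)
  then have "cyclic_group (subgroup_generated G ?H)" using cyclic_group_generated by simp
  then show ?thesis using sub inf fin unfolding virtually_infinite_cyclic_def by blast
qed

end

theorem proposition5:
  fixes G :: "('a, 'b) monoid_scheme"
  assumes "hyperbolic_group G"
    and "\<not> elementary_group G"
    and "torsion_free_group G"
  shows "property_star G"
proof -
  interpret group G using assms(1) by (simp add: hyperbolic_group_def)
  obtain X \<delta> where X: "finite X" "X \<subseteq> carrier G" "generate G X = carrier G" "\<delta> > 0"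
    "Metric_space.thin_triangles (cayley_space G X) (cayley_dist G X) \<delta>"
    using assms(1) unfolding hyperbolic_group_def by blast
  interpret H: hyperbolic_metric_group G "\<lambda>g h. real (cayley_vdist G X g h)" "3 * \<delta>"
    by (rule word_metric_hyperbolic[OF X])
  interpret nonelementary_hyperbolic_metric_group G "\<lambda>g h. real (cayley_vdist G X g h)" "3 * \<delta>"
  proof
    show "H.infinite_order g" if "g \<in> carrier G" "g \<noteq> \<one>\<^bsub>G\<^esub>" for g
      using assms(3) that unfolding torsion_free_group_def H.infinite_order_def by blast
    show "infinite (rcosets\<^bsub>G\<^esub> (H.powers w))" if w: "H.infinite_order w" for w
    proof
      assume "finite (rcosets\<^bsub>G\<^esub> (H.powers w))"
      moreover have "inj (\<lambda>j::int. w [^]\<^bsub>G\<^esub> j)" using H.infinite_order_pow_inj[OF w] by (auto intro: injI)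
      then have "infinite (H.powers w)" using finite_imageD infinite_UNIV_int by blast
      ultimately have "virtually_infinite_cyclic G"
        using finite_index_powers_imp_virtually_infinite_cyclic H.infinite_order_carrier[OF w] by blast
      then show False using assms(2) by (simp add: elementary_group_def)
    qed
    show "\<exists>g\<in>carrier G. g \<noteq> \<one>\<^bsub>G\<^esub>"
    proof (rule ccontr)
      assume "\<not> ?thesis"
      then have "carrier G \<subseteq> {\<one>\<^bsub>G\<^esub>}" by blast
      then have "finite (carrier G)" using finite_subset by blast
      then show False using assms(2) by (simp add: elementary_group_def)
    qed
  qed
  show ?thesis by (rule satisfies_property_star)
qed

end
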